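(* Let $F\in\mathcal{S}^{\mathrm{poly}}$ be such that in its functional equation $r=1$ and $\lambda_1=1$, i.e. $\Phi(s)=Q^s\Gamma(s+\mu)F(s)$ satisfies $\Phi(s)=\omega\overline{\Phi(1-\bar s)}$, with $0\le\mu<1$. Assume that all zeros $\rho$ of $F$ with $\operatorname{Im}\rho>0$ are simple. Then the function $f(z,F)$ (defined for $\operatorname{Im}z>0$, see context) has a meromorphic continuation to the half-plane $\operatorname{Im}z>-\pi$.
   Context: The Selberg class $\mathcal{S}$ consists of functions $F(s)=\sum_{n\ge1}a_F(n)n^{-s}$ ($s=\sigma+it$) such that: (i) the series converges absolutely for $\sigma>1$; (ii) for some integer $m\ge0$, $(s-1)^mF(s)$ is entire of finite order; (iii) $\Phi(s)=\omega\overline{\Phi(1-\bar s)}$ where $\Phi(s)=Q^s\prod_{j=1}^r\Gamma(\lambda_js+\mu_j)F(s)$ with $r\ge0$, $Q>0$, $\lambda_j>0$, $\operatorname{Re}\mu_j\ge0$, $|\omega|=1$; (iv) $a_F(n)\ll n^{\varepsilon}$ for every $\varepsilon>0$; (v) $F(s)=\prod_p\exp\big(\sum_{\ell\ge0}b_F(p^\ell)p^{-\ell s}\big)$ with $b_F(n)=0$ unless $n=p^m$, $m\ge1$, and $b_F(n)\ll n^{\vartheta}$ for some $\vartheta<1/2$. $\mathcal{S}^{\mathrm{poly}}$ is the set of $F\in\mathcal{S}$ having, for $\sigma>1$, a polynomial Euler product $F(s)=\prod_p\prod_{j=1}^d(1-\alpha_j(p)p^{-s})^{-1}$ with $|\alpha_j(p)|\le1$.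 $\zeta$ is the Riemann zeta function. For $\operatorname{Im}z>0$, $f(z,F)=\lim_{n\to\infty}\sum_{0<\operatorname{Im}\rho<T_n}e^{\rho z}\zeta(\rho-1)/F'(\rho)$, the sum over non-trivial zeros $\rho$ of $F$ (together with any trivial zeros of $F$ on the positive imaginary axis), where $(T_n)$ is chosen as follows: for large $T$ and $H=D\log\log T$ ($D$ a large constant), in each unit interval $[n,n+1]\subset[T-H,T+H]$ one picks $T_n$ with $|F(\sigma+iT_n)|^{-1}=O(\exp(C(\log T)^2))$ uniformly for $\sigma\ge-2$. *)

theory Defs
  imports
    "HOL-Complex_Analysis.Complex_Analysis"
    "HOL-Number_Theory.Number_Theory"
    "HOL-Library.Landau_Symbols"
begin

text \<open>The analytic continuation of $\sum_{n\ge1} n^{-s}$ to the plane without $1$; the value \<open>0\<close> at the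
  pole is a convention that makes the function unique.\<close>

definition riemann_zeta :: "complex \<Rightarrow> complex" where
  "riemann_zeta = (THE Z. Z holomorphic_on (- {1}) \<and> Z 1 = 0 \<and>
     (\<forall>s. Re s > 1 \<longrightarrow> Z s = (\<Sum>\<^sub>\<infinity>n\<in>{1::nat..}. of_nat n powr (- s))))"

definition entire_of_finite_order :: "(complex \<Rightarrow> complex) \<Rightarrow> bool" where
  "entire_of_finite_order G \<longleftrightarrow> G holomorphic_on UNIV \<and>
     (\<exists>\<kappa>::real. \<forall>\<^sub>F s in at_infinity. norm (G s) \<le> exp (norm s powr \<kappa>))"

definition gamma_poles :: "nat \<Rightarrow> (nat \<Rightarrow> real) \<Rightarrow> (nat \<Rightarrow> complex) \<Rightarrow> complex set" where
  "gamma_poles r lam \<mu> = {s. \<exists>j\<in>{1..r}. of_real (lam j) * s + \<mu> j \<in> \<int>\<^sub>\<le>\<^sub>0}"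

definition completed ::
  "(complex \<Rightarrow> complex) \<Rightarrow> real \<Rightarrow> nat \<Rightarrow> (nat \<Rightarrow> real) \<Rightarrow> (nat \<Rightarrow> complex) \<Rightarrow> complex \<Rightarrow> complex" where
  "completed F Q r lam \<mu> s =
     of_real Q powr s * (\<Prod>j\<in>{1..r}. Gamma (of_real (lam j) * s + \<mu> j)) * F s"

text \<open>The functional equation is an identity of meromorphic functions. Since \<open>Gamma\<close> and \<open>F\<close> take
  conventional values at their poles, it is required wherever every factor on both sides is
  regular; the pole of \<open>F\<close> can only be at \<open>1\<close>.\<close>

definition selberg_functional_equation ::
  "(complex \<Rightarrow> complex) \<Rightarrow> real \<Rightarrow> complex \<Rightarrow> nat \<Rightarrow> (nat \<Rightarrow> real) \<Rightarrow> (nat \<Rightarrow> complex) \<Rightarrow> bool" where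
  "selberg_functional_equation F Q \<omega> r lam \<mu> \<longleftrightarrow>
     Q > 0 \<and> norm \<omega> = 1 \<and> (\<forall>j\<in>{1..r}. lam j > 0 \<and> Re (\<mu> j) \<ge> 0) \<and>
     (\<forall>s. s \<notin> {0, 1} \<and> s \<notin> gamma_poles r lam \<mu> \<and> 1 - cnj s \<notin> gamma_poles r lam \<mu> \<longrightarrow>
        completed F Q r lam \<mu> s = \<omega> * cnj (completed F Q r lam \<mu> (1 - cnj s)))"

text \<open>Elements of the class are total functions; being nicely meromorphic only fixes the value at a
  possible pole at \<open>1\<close> (as \<open>0\<close>) and rules out a removable singularity there.\<close>

definition selberg_class :: "(complex \<Rightarrow> complex) set" where
  "selberg_class = {F.
     (\<exists>a :: nat \<Rightarrow> complex.
        (\<forall>s. Re s > 1 \<longrightarrow>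
           (\<lambda>n. norm (a n * of_nat n powr (- s))) summable_on {1..} \<and>
           F s = (\<Sum>\<^sub>\<infinity>n\<in>{1..}. a n * of_nat n powr (- s))) \<and>
        (\<forall>\<epsilon>>0. (\<lambda>n. norm (a n)) \<in> O(\<lambda>n. real n powr \<epsilon>))) \<and>
     F nicely_meromorphic_on UNIV \<and>
     (\<exists>(m::nat) G. entire_of_finite_order G \<and> (\<forall>s. s \<noteq> 1 \<longrightarrow> G s = (s - 1) ^ m * F s)) \<and>
     (\<exists>Q \<omega> r lam \<mu>. selberg_functional_equation F Q \<omega> r lam \<mu>) \<and>
     (\<exists>b :: nat \<Rightarrow> complex.
        (\<forall>n. \<not> primepow n \<longrightarrow> b n = 0) \<and>
        (\<exists>\<theta><1/2. (\<lambda>n. norm (b n)) \<in> O(\<lambda>n. real n powr \<theta>)) \<and>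
        (\<forall>s. Re s > 1 \<longrightarrow>
           (\<lambda>p. if prime p then exp (\<Sum>l. b (p ^ l) * of_nat p powr (- (of_nat l * s))) else 1)
             has_prod F s))}"

definition selberg_class_poly :: "(complex \<Rightarrow> complex) set" where
  "selberg_class_poly = {F \<in> selberg_class.
     \<exists>(d::nat) (\<alpha> :: nat \<Rightarrow> nat \<Rightarrow> complex).
       (\<forall>p j. prime p \<and> j \<in> {1..d} \<longrightarrow> norm (\<alpha> j p) \<le> 1) \<and>
       (\<forall>s. Re s > 1 \<longrightarrow>
          (\<lambda>p. if prime p then \<Prod>j\<in>{1..d}. inverse (1 - \<alpha> j p * of_nat p powr (- s)) else 1)
            has_prod F s)}"

definition zeros :: "(complex \<Rightarrow> complex) \<Rightarrow> complex set" where
  "zeros F = {\<rho>. F analytic_on {\<rho>} \<and> F \<rho> = 0}"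

text \<open>The trivial zeros are those located at poles of the Gamma factors.\<close>

definition trivial_zeros ::
  "(complex \<Rightarrow> complex) \<Rightarrow> nat \<Rightarrow> (nat \<Rightarrow> real) \<Rightarrow> (nat \<Rightarrow> complex) \<Rightarrow> complex set" where
  "trivial_zeros F r lam \<mu> = zeros F \<inter> gamma_poles r lam \<mu>"

definition nontrivial_zeros ::
  "(complex \<Rightarrow> complex) \<Rightarrow> nat \<Rightarrow> (nat \<Rightarrow> real) \<Rightarrow> (nat \<Rightarrow> complex) \<Rightarrow> complex set" where
  "nontrivial_zeros F r lam \<mu> = zeros F - gamma_poles r lam \<mu>"

text \<open>Non-vanishing is stated separately because \<open>1 / 0 = 0\<close>.\<close>

definition admissible_heights :: "(complex \<Rightarrow> complex) \<Rightarrow> (nat \<Rightarrow> real) \<Rightarrow> bool" where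
  "admissible_heights F \<tau> \<longleftrightarrow>
     (\<exists>D>0. \<exists>C K. \<forall>\<^sub>F T in at_top. \<forall>n::nat.
        {real n..real n + 1} \<subseteq> {T - D * ln (ln T)..T + D * ln (ln T)} \<longrightarrow>
          \<tau> n \<in> {real n..real n + 1} \<and>
          (\<forall>\<sigma>\<ge>-2. F (Complex \<sigma> (\<tau> n)) \<noteq> 0 \<and>
                  1 / norm (F (Complex \<sigma> (\<tau> n))) \<le> K * exp (C * (ln T)\<^sup>2)))"

definition f_partial ::
  "(complex \<Rightarrow> complex) \<Rightarrow> nat \<Rightarrow> (nat \<Rightarrow> real) \<Rightarrow> (nat \<Rightarrow> complex) \<Rightarrow> real \<Rightarrow> complex \<Rightarrow> complex" where
  "f_partial F r lam \<mu> T z =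
     (\<Sum>\<rho> | \<rho> \<in> nontrivial_zeros F r lam \<mu> \<union> {\<rho> \<in> trivial_zeros F r lam \<mu>. Re \<rho> = 0} \<and>
            0 < Im \<rho> \<and> Im \<rho> < T.
        exp (\<rho> * z) * riemann_zeta (\<rho> - 1) / deriv F \<rho>)"

definition f_fun ::
  "(complex \<Rightarrow> complex) \<Rightarrow> nat \<Rightarrow> (nat \<Rightarrow> real) \<Rightarrow> (nat \<Rightarrow> complex) \<Rightarrow> (nat \<Rightarrow> real) \<Rightarrow> complex \<Rightarrow> complex" where
  "f_fun F r lam \<mu> \<tau> z = lim (\<lambda>n. f_partial F r lam \<mu> (\<tau> n) z)"

end

theory Submission
  imports Defs "HOL-Real_Asymp.Real_Asymp"
begin

text \<open>
  Put \<open>H s = \<zeta>(s - 1) / F s\<close> and fix an admissible height \<open>T\<^sub>0\<close>. Up to the finitely many zeros below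
  \<open>T\<^sub>0\<close>, the partial sums of \<open>f\<close> are integrals of \<open>exp (s z) H s / (2 \<pi> i)\<close> over rectangles
  \<open>[-N, A] \<times> [T\<^sub>0, \<tau> n]\<close> with \<open>A\<close> large. By the functional equation of \<open>F\<close> and Euler--Maclaurin bounds for zeta,
  \<open>H\<close> decays faster than any exponential as \<open>Re s\<close> tends to minus infinity. Hence the left side disappears as
  \<open>N \<rightarrow> \<infinity>\<close> and the lower side converges to an entire function of \<open>z\<close>, while for \<open>Im z > 0\<close> the
  upper side is killed by \<open>exp (- \<tau> n Im z)\<close>. On \<open>Re s = A\<close> the function \<open>H\<close> is an absolutely convergent
  general Dirichlet series \<open>\<Sum> c\<^sub>i exp (- l\<^sub>i s)\<close>, and integrating it term by term turns the right side into
  \<open>- \<Sum> c\<^sub>i exp ((A + i T\<^sub>0) (z - l\<^sub>i)) / (z - l\<^sub>i)\<close>, which is meromorphic.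
\<close>

text \<open>The decay of \<open>H\<close> is a matter of degree. One Gamma factor with \<lambda> = 1
  gives \<open>F\<close> degree 2, while zeta has degree 1, so the factorial growth of
  \<open>F\<close> to the left beats that of zeta. For this to hold uniformly in Im s, both sides
  are measured by pochhammer products: Gamma quotients give one directly, and Euler-Maclaurin of
  order K, with K about |Re s|, bounds zeta (s - 1) by the product of length K starting at s - 1.
  The factors of the latter are then cancelled one by one.

  The reflection s -> 1 - cnj s preserves Im s. Therefore a bound for 1 / F on Re s \<ge> -2 at an
  admissible height controls the whole horizontal line, including its far left part.

  Since \<mu> is real, the poles of the Gamma factor are real, and all zeros with positive imaginary
  part are nontrivial and satisfy 0 \<le> Re \<rho> \<le> 1. Contours that stay above the real axis
  meet no pole of \<open>F\<close> or of zeta (s - 1).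

  The limit extends to the whole plane, with poles at most at the real exponents \<open>l i\<close>;
  these do not accumulate, because only finitely many indices have \<open>l i\<close> below a given
  bound.\<close>

section \<open>Analytic continuation and growth of the zeta function\<close>

text \<open>\<open>bern k u\<close> is the Bernoulli polynomial $B_k(u)/k!$, but only for \<open>u\<close> in \<open>[0, 1]\<close>.\<close>

primrec bern :: "nat \<Rightarrow> real \<Rightarrow> real" where
  "bern 0 = (\<lambda>u. 1)"
| "bern (Suc k) = (\<lambda>u. integral {0..u} (bern k) - integral {0..1} (\<lambda>v. integral {0..v} (bern k)))"

lemma continuous_on_bern: "continuous_on {0..1} (bern k)"
proof (induction k)
  case (Suc k)
  have "continuous_on {0..1} (\<lambda>u. integral {0..u} (bern k))"
    by (intro indefinite_integral_continuous_1 integrable_continuous_real Suc)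
  then show ?case by (auto intro!: continuous_intros)
qed simp

lemma has_real_derivative_bern:
  assumes "u \<in> {0..1}"
  shows "(bern (Suc k) has_real_derivative bern k u) (at u within {0..1})"
proof -
  have "((\<lambda>u. integral {0..u} (bern k)) has_real_derivative bern k u) (at u within {0..1})"
    by (rule integral_has_real_derivative[OF continuous_on_bern assms])
  then show ?thesis by (auto intro!: derivative_eq_intros)
qed

lemma integral_bern_Suc: "integral {0..1} (bern (Suc k)) = 0"
proof -
  have "continuous_on {0..1} (\<lambda>u. integral {0..u} (bern k))"
    by (intro indefinite_integral_continuous_1 integrable_continuous_real continuous_on_bern)
  then have "(\<lambda>u. integral {0..u} (bern k)) integrable_on {0..1}"
    by (rule integrable_continuous_real)
  from Henstock_Kurzweil_Integration.integral_diff[OF this integrable_const_ivl]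
  show ?thesis by simp
qed

text \<open>The increment over [0, 1] is the mean of \<open>bern k\<close>, which vanishes for k
  \<ge> 1. The exception is \<open>bern 1\<close>, which increases by 1.\<close>

lemma bern_periodic: "k \<ge> 1 \<Longrightarrow> bern (Suc k) 1 = bern (Suc k) 0"
  using integral_bern_Suc[of "k - 1"] by simp

lemma bern_1: "u \<in> {0..1} \<Longrightarrow> bern 1 u = u - 1/2"
proof -
  assume u: "u \<in> {0..1}"
  have "((\<lambda>v::real. v) has_integral (1\<^sup>2/2 - 0\<^sup>2/2)) {0..1}"
    by (rule fundamental_theorem_of_calculus)
       (auto intro!: derivative_eq_intros simp flip: has_real_derivative_iff_has_vector_derivative)
  then have "integral {0..1} (\<lambda>v::real. v) = 1/2"
    by (simp add: integral_unique)
  moreover have "integral {0..1} (\<lambda>v::real. integral {0..v} (\<lambda>u. 1::real)) = integral {0..1} (\<lambda>v::real. v)"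
    by (rule Henstock_Kurzweil_Integration.integral_cong) auto
  ultimately show ?thesis using u by simp
qed

text \<open>By induction the derivative is bounded by 1, so two values differ by at most 1.
  Averaging the difference over the second point leaves the value at the first, because the mean is
  zero.\<close>

lemma abs_bern_le_1: "u \<in> {0..1} \<Longrightarrow> \<bar>bern k u\<bar> \<le> 1"
proof (induction k arbitrary: u)
  case (Suc k)
  let ?p = "bern (Suc k)"
  have lip: "\<bar>?p x - ?p y\<bar> \<le> 1" if "x \<in> {0..1}" "y \<in> {0..1}" for x y
  proof -
    have "norm (?p x - ?p y) \<le> 1 * norm (x - y)"
      by (rule field_differentiable_bound[where S="{0..1}" and f'="bern k"])
         (use has_real_derivative_bern Suc.IH that in auto)
    also have "\<dots> \<le> 1" using that by auto
    finally show ?thesis by simp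
  qed
  have int: "?p integrable_on {0..1}"
    by (intro integrable_continuous_real continuous_on_bern)
  have "integral {0..1} (\<lambda>v. ?p u - ?p v) = ?p u"
    using integral_bern_Suc[of k] int by (subst integral_diff) (auto simp del: bern.simps)
  moreover have "norm (integral {0..1} (\<lambda>v. ?p u - ?p v)) \<le> integral {0..1} (\<lambda>v::real. 1::real)"
    by (rule integral_norm_bound_integral)
       (use int lip Suc.prems in \<open>auto intro!: integrable_diff simp del: bern.simps\<close>)
  ultimately show ?case by simp
qed simp

section \<open>Euler-Maclaurin remainder integrals\<close>

lemma summable_on_nat_powr:
  assumes "x > 1"
  shows "(\<lambda>n::nat. real n powr (- x)) summable_on A"
proof -
  have "summable (\<lambda>n::nat. norm (real n powr (- x)))"
    using assms by (simp add: summable_real_powr_iff)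
  then have "(\<lambda>n::nat. real n powr (- x)) summable_on UNIV"
    by (rule norm_summable_imp_summable_on)
  then show ?thesis by (rule summable_on_subset_banach) auto
qed

lemma norm_nat_add_powr:
  assumes "n \<ge> 1" "u \<ge> 0"
  shows "norm ((of_nat n + of_real u) powr w :: complex) = (real n + u) powr Re w"
proof -
  have "of_nat n + of_real u = complex_of_real (real n + u)" by simp
  then show ?thesis using assms by (simp add: norm_powr_real_powr del: of_real_add)
qed

text \<open>With x = n + u this integrates the periodized Bernoulli function against x powr (-(s +
  k)) over [n, n + 1]: one cell of the Euler-Maclaurin remainder of order k, without its pochhammer
  factor.\<close>

definition em_term :: "nat \<Rightarrow> nat \<Rightarrow> complex \<Rightarrow> complex" where
  "em_term k n s =
     integral {0..1} (\<lambda>u. of_real (bern k u) * (of_nat n + of_real u) powr (- (s + of_nat k)))"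

lemma nat_add_notin_nonpos_Reals: "n \<ge> 1 \<Longrightarrow> u \<ge> 0 \<Longrightarrow> of_nat n + of_real u \<notin> (\<real>\<^sub>\<le>\<^sub>0 :: complex set)"
  by (auto simp: complex_nonpos_Reals_iff)

lemma nat_add_nonzero: "n \<ge> 1 \<Longrightarrow> u \<ge> 0 \<Longrightarrow> of_nat n + of_real u \<noteq> (0 :: complex)"
  using nat_add_notin_nonpos_Reals[of n u] by auto

lemma nat_add_powr_has_vector_derivative:
  assumes "n \<ge> 1" "u \<in> {0..1}"
  shows "((\<lambda>u. (of_nat n + of_real u) powr w :: complex) has_vector_derivative
          w * (of_nat n + of_real u) powr (w - 1)) (at u within {0..1})"
proof -
  have "((\<lambda>x. (of_nat n + x) powr w) has_field_derivative w * (of_nat n + of_real u) powr (w - 1))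
          (at (complex_of_real u))"
    using nat_add_notin_nonpos_Reals[of n u] assms by (auto intro!: derivative_eq_intros)
  then show ?thesis
    by (rule has_vector_derivative_real_field)
qed

lemma continuous_on_nat_add_powr:
  assumes "n \<ge> 1"
  shows "continuous_on {0..1} (\<lambda>u. (of_nat n + of_real u) powr w :: complex)"
  using nat_add_notin_nonpos_Reals[OF assms] nat_add_nonzero[OF assms] by (intro continuous_intros) auto

lemma em_term_integrable:
  assumes "n \<ge> 1"
  shows "(\<lambda>u. complex_of_real (bern k u) * (of_nat n + of_real u) powr w) integrable_on {0..1}"
  by (intro integrable_continuous_real continuous_intros continuous_on_bern continuous_on_nat_add_powr assms)

lemma norm_em_term:
  assumes "n \<ge> 1" "Re s + real k \<ge> 0"
  shows "norm (em_term k n s) \<le> real n powr (- (Re s + real k))"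
proof -
  have "norm (em_term k n s) \<le> integral {0..1} (\<lambda>u::real. real n powr (- (Re s + real k)))"
    unfolding em_term_def
  proof (rule integral_norm_bound_integral)
    fix u :: real assume u: "u \<in> {0..1}"
    have "norm (of_real (bern k u) * (of_nat n + of_real u) powr (- (s + of_nat k)))
           = \<bar>bern k u\<bar> * (real n + u) powr (- (Re s + real k))"
      using u assms by (simp add: norm_mult norm_nat_add_powr)
    also have "\<dots> \<le> 1 * real n powr (- (Re s + real k))"
      using u assms by (intro mult_mono abs_bern_le_1 powr_mono2') auto
    finally show "norm (of_real (bern k u) * (of_nat n + of_real u) powr (- (s + of_nat k)))
       \<le> real n powr (- (Re s + real k))" by simp
  qed (use em_term_integrable assms in auto)
  then show ?thesis by simp
qed

text \<open>Integration by parts with \<open>bern (Suc k)\<close> as a primitive of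
  \<open>bern k\<close>; differentiating the power produces the factor s + k.\<close>

lemma em_term_rec:
  assumes "n \<ge> 1"
  shows "em_term k n s = of_real (bern (Suc k) 1) * of_nat (Suc n) powr (- (s + of_nat k))
           - of_real (bern (Suc k) 0) * of_nat n powr (- (s + of_nat k))
           + (s + of_nat k) * em_term (Suc k) n s"
proof -
  define w where "w = - (s + of_nat k)"
  let ?P = "\<lambda>u. complex_of_real (bern (Suc k) u)" and ?X = "\<lambda>w u. (of_nat n + complex_of_real u) powr w"
  have "((\<lambda>u. ?P u * (w * ?X (w - 1) u) + of_real (bern k u) * ?X w u) has_integral
          ?P 1 * ?X w 1 - ?P 0 * ?X w 0) {0..1}"
  proof (rule fundamental_theorem_of_calculus)
    fix u :: real assume u: "u \<in> {0..1}"
    have "(?P has_vector_derivative of_real (bern k u)) (at u within {0..1})"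
      using has_real_derivative_bern[OF u, of k]
      by (auto intro!: has_vector_derivative_of_real simp: has_real_derivative_iff_has_vector_derivative
          simp del: bern.simps)
    from has_vector_derivative_mult[OF this nat_add_powr_has_vector_derivative[OF assms u]]
    show "((\<lambda>u. ?P u * ?X w u) has_vector_derivative
        ?P u * (w * ?X (w - 1) u) + of_real (bern k u) * ?X w u) (at u within {0..1})" .
  qed simp
  moreover have "((\<lambda>u. ?P u * (w * ?X (w - 1) u) + of_real (bern k u) * ?X w u) has_integral
      w * em_term (Suc k) n s + em_term k n s) {0..1}"
  proof (rule has_integral_add)
    have "w - 1 = - (s + of_nat (Suc k))" by (simp add: w_def)
    then have "((\<lambda>u. ?P u * ?X (w - 1) u) has_integral em_term (Suc k) n s) {0..1}"
      unfolding em_term_def by (simp only: integrable_integral[OF em_term_integrable[OF assms]])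
    from has_integral_mult_right[OF this, of w]
    show "((\<lambda>u. ?P u * (w * ?X (w - 1) u)) has_integral w * em_term (Suc k) n s) {0..1}"
      by (simp add: mult_ac del: bern.simps)
    show "((\<lambda>u. of_real (bern k u) * ?X w u) has_integral em_term k n s) {0..1}"
      unfolding em_term_def w_def by (rule integrable_integral[OF em_term_integrable[OF assms]])
  qed
  ultimately have "?P 1 * ?X w 1 - ?P 0 * ?X w 0 = w * em_term (Suc k) n s + em_term k n s"
    by (rule has_integral_unique)
  then show ?thesis by (simp add: w_def algebra_simps del: bern.simps)
qed

lemma em_term_0:
  assumes "n \<ge> 1" "s \<noteq> 1"
  shows "em_term 0 n s = (of_nat n powr (1 - s) - of_nat (Suc n) powr (1 - s)) / (s - 1)"
proof -
  let ?X = "\<lambda>w u. (of_nat n + complex_of_real u) powr w"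
  have "((\<lambda>u. (1 - s) * ?X (1 - s - 1) u) has_integral ?X (1 - s) 1 - ?X (1 - s) 0) {0..1}"
    by (intro fundamental_theorem_of_calculus nat_add_powr_has_vector_derivative assms) auto
  from has_integral_divide[OF this, of "1 - s"]
  have "((\<lambda>u. of_real (bern 0 u) * ?X (- (s + of_nat 0)) u) has_integral
     (?X (1 - s) 1 - ?X (1 - s) 0) / (1 - s)) {0..1}"
    using assms by simp
  then show ?thesis
    unfolding em_term_def using assms by (subst integral_unique) (auto simp: field_simps)
qed

lemma em_term_holomorphic:
  assumes "n \<ge> 1"
  shows "em_term k n holomorphic_on UNIV"
proof -
  have "(\<lambda>s. integral (cbox 0 1) (\<lambda>u. of_real (bern k u) * (of_nat n + complex_of_real u) powr (- (s + of_nat k))))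
          holomorphic_on UNIV"
  proof (rule leibniz_rule_holomorphic)
    fix s :: complex and u :: real assume u: "u \<in> cbox 0 1"
    have nz: "of_nat n + complex_of_real u \<noteq> 0"
      using nat_add_notin_nonpos_Reals[of n u] u assms by auto
    show "((\<lambda>s. of_real (bern k u) * (of_nat n + complex_of_real u) powr (- (s + of_nat k)))
        has_field_derivative (- of_real (bern k u) * Ln (of_nat n + complex_of_real u)
           * (of_nat n + complex_of_real u) powr (- (s + of_nat k)))) (at s within UNIV)"
      using nz by (auto intro!: derivative_eq_intros simp: powr_def)
  next
    fix s :: complex
    show "(\<lambda>u. of_real (bern k u) * (of_nat n + complex_of_real u) powr (- (s + of_nat k)))
        integrable_on cbox 0 1"
      using em_term_integrable[OF assms] by (simp add: cbox_interval)
  next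
    have "continuous_on (UNIV \<times> {0..1}) (\<lambda>x::complex \<times> real. bern k (snd x))"
      by (rule continuous_on_compose2[OF continuous_on_bern]) (auto intro!: continuous_intros)
    then show "continuous_on (UNIV \<times> cbox 0 1) (\<lambda>(s, u). - complex_of_real (bern k u)
        * Ln (of_nat n + complex_of_real u) * (of_nat n + complex_of_real u) powr (- (s + of_nat k)))"
      unfolding case_prod_unfold using nat_add_notin_nonpos_Reals[OF assms] nat_add_nonzero[OF assms]
      by (intro continuous_intros) (auto simp: cbox_interval)
  qed auto
  then show ?thesis by (simp add: em_term_def[abs_def] cbox_interval)
qed

lemma image_Suc_atLeast: "Suc ` {k..} = {Suc k..}"
proof
  show "{Suc k..} \<subseteq> Suc ` {k..}"
  proof
    fix x assume "x \<in> {Suc k..}"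
    then have "x = Suc (x - 1)" "x - 1 \<in> {k..}" by auto
    then show "x \<in> Suc ` {k..}" by (rule image_eqI)
  qed
qed auto

lemma image_Suc_UNIV: "range Suc = {1..}"
  using image_Suc_atLeast[of 0] by (simp add: atLeast_0)

lemma has_sum_diff:
  fixes f g :: "'a \<Rightarrow> complex"
  assumes "(f has_sum a) A" "(g has_sum b) A"
  shows "((\<lambda>x. f x - g x) has_sum (a - b)) A"
  using has_sum_add[OF assms(1) has_sum_cmult_right[OF assms(2), of "-1"]] by simp

definition em_sum :: "nat \<Rightarrow> complex \<Rightarrow> complex" where
  "em_sum k s = (\<Sum>\<^sub>\<infinity>n\<in>{1..}. em_term k n s)"

lemma em_term_summable:
  assumes "Re s + real k > 1"
  shows "(\<lambda>n. em_term k n s) summable_on {1..}"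
proof (rule abs_summable_summable, rule summable_on_comparison_test)
  show "(\<lambda>n. real n powr (- (Re s + real k))) summable_on {1..}"
    by (rule summable_on_nat_powr[OF assms])
qed (use assms norm_em_term in auto)

lemma em_sum_holomorphic: "em_sum k holomorphic_on {s. Re s + real k > 1}"
proof -
  have "em_sum k field_differentiable at s" if s: "Re s + real k > 1" for s
  proof -
    \<comment> \<open>\<open>x\<close> is the midpoint of 1 and Re s + k, and \<open>r\<close> is
      its distance to either, so Re w + k \<ge> x > 1 on the closed ball and a single convergent
      majorant serves there.\<close>
    define x where "x = (Re s + real k + 1) / 2"
    define r where "r = (Re s + real k - 1) / 2"
    have x: "x > 1" "r > 0" using s by (auto simp: x_def r_def)
    have ul: "uniform_limit (cball s r) (\<lambda>X s. \<Sum>n\<in>X. em_term k n s) (em_sum k) (finite_subsets_at_top {1..})"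
      unfolding em_sum_def[abs_def]
    proof (rule Weierstrass_m_test_general[where M = "\<lambda>n. real n powr (- x)"])
      fix n :: nat and w assume n: "n \<in> {1..}" and w: "w \<in> cball s r"
      have "\<bar>Re s - Re w\<bar> \<le> r"
        using abs_Re_le_cmod[of "s - w"] w by (simp add: dist_norm)
      then have le: "x \<le> Re w + real k" by (simp add: x_def r_def abs_if field_simps split: if_splits)
      then have "norm (em_term k n w) \<le> real n powr (- (Re w + real k))"
        using n x by (intro norm_em_term) auto
      also have "\<dots> \<le> real n powr (- x)"
        using le n by (intro powr_mono) auto
      finally show "norm (em_term k n w) \<le> real n powr (- x)" .
    qed (rule summable_on_nat_powr[OF x(1)])
    have ev: "\<forall>\<^sub>F X in finite_subsets_at_top {1..}. continuous_on (cball s r) (\<lambda>s. \<Sum>n\<in>X. em_term k n s)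
        \<and> (\<lambda>s. \<Sum>n\<in>X. em_term k n s) holomorphic_on ball s r"
    proof (rule eventually_finite_subsets_at_top_weakI)
      fix X :: "nat set" assume "X \<subseteq> {1..}"
      then have "(\<lambda>s. \<Sum>n\<in>X. em_term k n s) holomorphic_on UNIV"
        by (intro holomorphic_on_sum em_term_holomorphic) auto
      then show "continuous_on (cball s r) (\<lambda>s. \<Sum>n\<in>X. em_term k n s)
        \<and> (\<lambda>s. \<Sum>n\<in>X. em_term k n s) holomorphic_on ball s r"
        using holomorphic_on_imp_continuous_on holomorphic_on_subset by blast
    qed
    have "em_sum k holomorphic_on ball s r"
      by (rule holomorphic_uniform_limit[OF ev ul]) auto
    then show ?thesis
      using x by (meson centre_in_ball holomorphic_on_imp_differentiable_at open_ball)
  qed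
  then show ?thesis
    by (auto simp: holomorphic_on_def intro: field_differentiable_at_within)
qed

lemma norm_em_sum:
  assumes "Re s + real k \<ge> 2"
  shows "norm (em_sum k s) \<le> 2"
proof -
  have "norm (em_sum k s) \<le> (\<Sum>\<^sub>\<infinity>n\<in>{1..}. real n powr (- 2))"
    unfolding em_sum_def
  proof (rule norm_infsum_le)
    show "((\<lambda>n. em_term k n s) has_sum (\<Sum>\<^sub>\<infinity>n\<in>{1..}. em_term k n s)) {1..}"
      using em_term_summable[of s k] assms by (auto simp: has_sum_infsum)
    show "((\<lambda>n::nat. real n powr (- 2)) has_sum (\<Sum>\<^sub>\<infinity>n\<in>{1..}. real n powr (- 2))) {1..}"
      using summable_on_nat_powr[of 2] by (auto simp: has_sum_infsum)
    fix n :: nat assume n: "n \<in> {1..}"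
    have "norm (em_term k n s) \<le> real n powr (- (Re s + real k))"
      using n assms by (intro norm_em_term) auto
    also have "\<dots> \<le> real n powr (- 2)"
      using assms n by (intro powr_mono) auto
    finally show "norm (em_term k n s) \<le> real n powr (- 2)" .
  qed
  also have "(\<Sum>\<^sub>\<infinity>n\<in>{1..}. real n powr (- 2)) = (\<Sum>\<^sub>\<infinity>n. 1 / real (Suc n)^2)"
    using infsum_reindex[of Suc UNIV "\<lambda>n. real n powr (- 2)"]
    by (simp add: o_def powr_minus powr_realpow divide_inverse image_Suc_UNIV)
  also have "\<dots> = pi\<^sup>2 / 6"
    using inverse_squares_sums by (intro infsumI norm_summable_imp_has_sum) (auto dest: sums_summable)
  also have "\<dots> \<le> 2"
  proof -
    have "pi\<^sup>2 \<le> (3.2)\<^sup>2" using pi_approx by (intro power_mono) auto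
    then show ?thesis by (simp add: power2_eq_square)
  qed
  finally show ?thesis .
qed

lemma summable_on_nat_powr_complex:
  assumes "Re s > 1"
  shows "(\<lambda>n::nat. of_nat n powr (- s) :: complex) summable_on A"
proof (rule abs_summable_summable, rule summable_on_comparison_test)
  show "(\<lambda>n. real n powr (- Re s)) summable_on A"
    by (rule summable_on_nat_powr[OF assms])
  show "norm (of_nat n powr (- s) :: complex) \<le> real n powr - Re s" for n :: nat
    by (cases "n = 0") (use norm_nat_add_powr[of n 0 "- s"] in auto)
qed auto

section \<open>The Dirichlet series of zeta and its continuation\<close>

definition dzeta :: "complex \<Rightarrow> complex" where
  "dzeta s = (\<Sum>\<^sub>\<infinity>n\<in>{1::nat..}. of_nat n powr (- s))"

text \<open>Handles the boundary values at n + 1 in \<open>em_term_rec\<close>: they form the same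
  series without its first term.\<close>

lemma dzeta_shift:
  assumes "Re s > 1"
  shows "((\<lambda>n. of_nat (Suc n) powr (- s)) has_sum (dzeta s - 1)) {1::nat..}"
proof -
  have "{1::nat..} = insert 1 {2..}" by auto
  then have "dzeta s = 1 + (\<Sum>\<^sub>\<infinity>n\<in>{2::nat..}. of_nat n powr (- s))"
    unfolding dzeta_def using summable_on_nat_powr_complex[OF assms] by (simp add: infsum_insert)
  moreover have "((\<lambda>n::nat. of_nat n powr (- s)) has_sum (\<Sum>\<^sub>\<infinity>n\<in>{2::nat..}. of_nat n powr (- s))) (Suc ` {1..})"
    using summable_on_nat_powr_complex[OF assms] by (simp add: image_Suc_atLeast numeral_2_eq_2)
  ultimately show ?thesis
    by (subst (asm) has_sum_reindex) (auto simp: o_def)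
qed

text \<open>Sum the integration by parts over n. By periodicity both boundary values carry the same
  coefficient, so the boundary terms telescope to the one at n = 1. This is done as a difference of
  two zeta series at s + k, which converge for Re s + k > 1.\<close>

lemma em_sum_rec:
  assumes "Re s + real k > 1" "k \<ge> 1"
  shows "em_sum k s = - of_real (bern (Suc k) 0) + (s + of_nat k) * em_sum (Suc k) s"
proof -
  let ?w = "s + of_nat k" and ?b = "complex_of_real (bern (Suc k) 0)"
  have 1: "((\<lambda>n. ?b * of_nat (Suc n) powr (- ?w)) has_sum ?b * (dzeta ?w - 1)) {1::nat..}"
    using assms by (intro has_sum_cmult_right dzeta_shift) auto
  have 2: "((\<lambda>n. ?b * of_nat n powr (- ?w)) has_sum ?b * dzeta ?w) {1::nat..}"
    using assms summable_on_nat_powr_complex[of ?w]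
    by (intro has_sum_cmult_right) (auto simp: dzeta_def has_sum_infsum)
  have 3: "((\<lambda>n. ?w * em_term (Suc k) n s) has_sum ?w * em_sum (Suc k) s) {1..}"
    using assms em_term_summable[of s "Suc k"]
    by (intro has_sum_cmult_right) (auto simp: em_sum_def has_sum_infsum)
  have "((\<lambda>n. em_term k n s) has_sum ?b * (dzeta ?w - 1) - ?b * dzeta ?w + ?w * em_sum (Suc k) s) {1..}"
  proof (subst has_sum_cong)
    show "((\<lambda>n. ?b * of_nat (Suc n) powr (- ?w) - ?b * of_nat n powr (- ?w) + ?w * em_term (Suc k) n s)
       has_sum ?b * (dzeta ?w - 1) - ?b * dzeta ?w + ?w * em_sum (Suc k) s) {1..}"
      by (intro has_sum_add has_sum_diff 1 2 3)
    show "em_term k n s = ?b * of_nat (Suc n) powr (- ?w) - ?b * of_nat n powr (- ?w) + ?w * em_term (Suc k) n s"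
      if "n \<in> {1..}" for n
      using that em_term_rec[of n k s] bern_periodic[OF assms(2)] by (simp del: bern.simps)
  qed
  then show ?thesis by (simp add: em_sum_def infsumI algebra_simps del: bern.simps)
qed

lemma em_sum_0:
  assumes "Re s > 1"
  shows "em_sum 0 s = 1 / (s - 1)"
proof -
  have s: "s \<noteq> 1" using assms by auto
  have "((\<lambda>n. em_term 0 n s) has_sum em_sum 0 s) (Suc ` UNIV)"
    using em_term_summable[of s 0] assms
    by (simp add: em_sum_def has_sum_infsum image_Suc_UNIV)
  then have "((\<lambda>n. em_term 0 (Suc n) s) has_sum em_sum 0 s) UNIV"
    by (subst (asm) has_sum_reindex) (auto simp: o_def)
  then have 1: "(\<lambda>n. em_term 0 (Suc n) s) sums em_sum 0 s"
    by (rule has_sum_imp_sums)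
  have "(\<lambda>n. of_nat (Suc n) powr (1 - s) :: complex) \<longlonglongrightarrow> 0"
  proof (rule tendsto_norm_zero_cancel)
    have "(\<lambda>n. real (Suc n) powr (1 - Re s)) \<longlonglongrightarrow> 0"
      using assms by (intro tendsto_neg_powr filterlim_compose[OF filterlim_real_sequentially] filterlim_Suc) auto
    then show "(\<lambda>n. norm (of_nat (Suc n) powr (1 - s) :: complex)) \<longlonglongrightarrow> 0"
      using norm_nat_add_powr[of "Suc n" 0 "1 - s" for n] by simp
  qed
  from telescope_sums'[OF this]
  have "(\<lambda>n. (of_nat (Suc n) powr (1 - s) - of_nat (Suc (Suc n)) powr (1 - s)) / (s - 1)) sums (1 / (s - 1))"
    by (intro sums_divide) simp
  then have "(\<lambda>n. em_term 0 (Suc n) s) sums (1 / (s - 1))"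
    using s by (simp add: em_term_0)
  with 1 show ?thesis by (rule sums_unique2)
qed

text \<open>The first integration by parts is special: \<open>bern 1\<close> is -1/2 and 1/2 at the
  endpoints, so the boundary terms add up as in the trapezoidal rule, and zeta itself
  appears.\<close>

lemma dzeta_em_sum_1:
  assumes "Re s > 1"
  shows "dzeta s = 1 / (s - 1) + 1 / 2 - s * em_sum 1 s"
proof -
  have 1: "((\<lambda>n. 1/2 * of_nat (Suc n) powr (- s)) has_sum 1/2 * (dzeta s - 1)) {1::nat..}"
    using assms by (intro has_sum_cmult_right dzeta_shift) auto
  have 2: "((\<lambda>n. 1/2 * of_nat n powr (- s)) has_sum 1/2 * dzeta s) {1::nat..}"
    using assms summable_on_nat_powr_complex[of s]
    by (intro has_sum_cmult_right) (auto simp: dzeta_def has_sum_infsum)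
  have 3: "((\<lambda>n. s * em_term 1 n s) has_sum s * em_sum 1 s) {1..}"
    using assms em_term_summable[of s 1]
    by (intro has_sum_cmult_right) (auto simp: em_sum_def has_sum_infsum)
  have "((\<lambda>n. em_term 0 n s) has_sum 1/2 * (dzeta s - 1) + 1/2 * dzeta s + s * em_sum 1 s) {1..}"
  proof (subst has_sum_cong)
    show "((\<lambda>n. 1/2 * of_nat (Suc n) powr (- s) + 1/2 * of_nat n powr (- s) + s * em_term 1 n s)
       has_sum 1/2 * (dzeta s - 1) + 1/2 * dzeta s + s * em_sum 1 s) {1..}"
      by (intro has_sum_add 1 2 3)
    show "em_term 0 n s = 1/2 * of_nat (Suc n) powr (- s) + 1/2 * of_nat n powr (- s) + s * em_term 1 n s"
      if "n \<in> {1..}" for n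
      using that em_term_rec[of n 0 s] bern_1[of 0] bern_1[of 1] unfolding One_nat_def by (simp del: bern.simps)
  qed
  then have "em_sum 0 s = 1/2 * (dzeta s - 1) + 1/2 * dzeta s + s * em_sum 1 s"
    by (simp add: em_sum_def infsumI)
  with em_sum_0[OF assms] show ?thesis by (simp add: field_simps)
qed

text \<open>Euler--Maclaurin of order \<open>K\<close>: this represents zeta for \<open>Re s > 1 - K\<close>.\<close>

definition em_zeta :: "nat \<Rightarrow> complex \<Rightarrow> complex" where
  "em_zeta K s = 1 / (s - 1) + 1 / 2 + (\<Sum>j=1..<K. of_real (bern (Suc j) 0) * pochhammer s j)
     - pochhammer s K * em_sum K s"

text \<open>Inserting \<open>em_sum_rec\<close> into the remainder releases exactly the next term of
  the finite sum.\<close>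

lemma em_zeta_Suc:
  assumes "Re s + real K > 1" "K \<ge> 1"
  shows "em_zeta (Suc K) s = em_zeta K s"
  using assms(2)
  by (simp add: em_zeta_def em_sum_rec[OF assms] pochhammer_Suc algebra_simps del: bern.simps)

lemma em_zeta_le:
  assumes "Re s + real K > 1" "K \<ge> 1" "K \<le> L"
  shows "em_zeta L s = em_zeta K s"
  using assms(3)
proof (induction L rule: dec_induct)
  case (step n)
  then show ?case using em_zeta_Suc[of s n] assms by auto
qed auto

lemma em_zeta_holomorphic: "em_zeta K holomorphic_on {s. Re s + real K > 1} - {1}"
proof -
  have "(\<lambda>s. pochhammer s j) holomorphic_on A" for j and A :: "complex set"
    by (induction j) (auto simp: pochhammer_Suc intro!: holomorphic_intros)
  moreover have "em_sum K holomorphic_on {s. Re s + real K > 1} - {1}"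
    by (rule holomorphic_on_subset[OF em_sum_holomorphic]) auto
  ultimately show ?thesis
    unfolding em_zeta_def[abs_def] by (intro holomorphic_intros) auto
qed

text \<open>The description operator needs existence, by gluing the representations of all orders,
  and uniqueness, by the identity theorem on the connected set \<open>- {1}\<close>.\<close>

lemma riemann_zeta_props:
  shows riemann_zeta_holomorphic: "riemann_zeta holomorphic_on (- {1})"
    and riemann_zeta_dzeta: "Re s > 1 \<Longrightarrow> riemann_zeta s = dzeta s"
    and riemann_zeta_em_zeta: "Re s + real K > 1 \<Longrightarrow> K \<ge> 1 \<Longrightarrow> s \<noteq> 1 \<Longrightarrow> riemann_zeta s = em_zeta K s"
proof -
  let ?P = "\<lambda>Z. Z holomorphic_on (- {1}) \<and> Z 1 = 0 \<and> (\<forall>s. Re s > 1 \<longrightarrow> Z s = dzeta s)"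
  \<comment> \<open>An order that converges at the given point; by \<open>em_zeta_le\<close>,
    through the maximum of two orders, the value does not depend on the choice.\<close>
  define K where "K = (\<lambda>s. nat \<lceil>2 - Re s\<rceil> + 1)"
  have K: "Re s + real (K s) > 1" "K s \<ge> 1" for s
  proof -
    have "real (nat \<lceil>2 - Re s\<rceil>) \<ge> 2 - Re s" by linarith
    then show "Re s + real (K s) > 1" "K s \<ge> 1" by (auto simp: K_def)
  qed
  define Z where "Z = (\<lambda>s. if s = 1 then 0 else em_zeta (K s) s)"
  have Z_eq: "Z s = em_zeta k s" if "Re s + real k > 1" "k \<ge> 1" "s \<noteq> 1" for s k
    using that em_zeta_le[of s k "max k (K s)"] em_zeta_le[of s "K s" "max k (K s)"] K[of s]
    by (simp add: Z_def)
  have "Z field_differentiable at s" if "s \<noteq> 1" for s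
  proof -
    let ?S = "{w. Re w + real (K s) > 1} - {1}"
    have op: "open ?S"
      by (intro open_Diff open_Collect_less continuous_intros)
    have "Z holomorphic_on ?S"
      using em_zeta_holomorphic[of "K s"] by (rule holomorphic_transform) (use Z_eq K in auto)
    then show ?thesis
      using op that K[of s] by (auto intro: holomorphic_on_imp_differentiable_at)
  qed
  then have "Z holomorphic_on (- {1})"
    by (auto simp: holomorphic_on_def intro: field_differentiable_at_within)
  moreover have "Z s = dzeta s" if "Re s > 1" for s
    using that Z_eq[of s 1] dzeta_em_sum_1[of s] by (cases "s = 1") (auto simp: em_zeta_def)
  ultimately have PZ: "?P Z" by (simp add: Z_def)
  have "riemann_zeta = Z"
    unfolding riemann_zeta_def dzeta_def[symmetric]
  proof (rule the_equality)
    fix Y assume Y: "?P Y"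
    show "Y = Z"
    proof
      fix s
      show "Y s = Z s"
      proof (cases "s = 1")
        case False
        have "Y s - Z s = 0"
        proof (rule analytic_continuation[where S = "- {1}" and U = "{s. Re s > 1}" and \<xi> = 2
              and f = "\<lambda>s. Y s - Z s"])
          show "(\<lambda>s. Y s - Z s) holomorphic_on - {1}"
            using Y PZ by (intro holomorphic_intros) auto
          show "connected (- {1::complex})"
            by (rule connected_punctured_universe) auto
          have "open {s. Re s > 1}" by (simp add: open_halfspace_Re_gt)
          then show "2 islimpt {s. Re s > 1}"
            by (intro interior_limit_point) (simp add: interior_open)
        qed (use Y PZ False in auto)
        then show ?thesis by simp
      qed (use Y PZ in auto)
    qed
  qed (use PZ in auto)
  then show "riemann_zeta holomorphic_on (- {1})" "Re s > 1 \<Longrightarrow> riemann_zeta s = dzeta s"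
     "Re s + real K > 1 \<Longrightarrow> K \<ge> 1 \<Longrightarrow> s \<noteq> 1 \<Longrightarrow> riemann_zeta s = em_zeta K s" for s K
    using PZ Z_eq by auto
qed

text \<open>For Im s \<ge> 1 each factor of the pochhammer product has modulus at least 1, so the
  longest product dominates the shorter ones. The constant covers 1 for the pole term, 1/2, K - 1
  for the finite sum and 2 for the remainder.\<close>

lemma norm_riemann_zeta_le:
  assumes "Im s \<ge> 1" "Re s + real K \<ge> 2" "K \<ge> 1"
  shows "norm (riemann_zeta s) \<le> (real K + 3) * norm (pochhammer s K)"
proof -
  have im: "1 \<le> norm (s + of_nat i)" for i
    using abs_Im_le_cmod[of "s + of_nat i"] assms by auto
  have mono: "norm (pochhammer s j) \<le> norm (pochhammer s L)" if "j \<le> L" for j L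
    using that
  proof (induction L rule: dec_induct)
    case (step n)
    have "norm (pochhammer s j) \<le> norm (pochhammer s n) * 1" using step by simp
    also have "\<dots> \<le> norm (pochhammer s (Suc n))"
      unfolding pochhammer_Suc norm_mult by (intro mult_left_mono im) auto
    finally show ?case .
  qed auto
  let ?N = "norm (pochhammer s K)"
  have one: "1 \<le> ?N" using mono[of 0 K] by simp
  have "s \<noteq> 1" using assms by auto
  have a: "norm (1 / (s - 1)) \<le> 1"
    using abs_Im_le_cmod[of "s - 1"] assms by (auto simp: norm_divide divide_simps)
  have b: "norm (\<Sum>j=1..<K. of_real (bern (Suc j) 0) * pochhammer s j) \<le> (\<Sum>j=1..<K. ?N)"
  proof (rule sum_norm_le)
    fix j assume "j \<in> {1..<K}"
    have "norm (of_real (bern (Suc j) 0) * pochhammer s j) \<le> 1 * ?N"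
      unfolding norm_mult using \<open>j \<in> _\<close> abs_bern_le_1[of 0 "Suc j"]
      by (intro mult_mono mono) (auto simp del: bern.simps)
    then show "norm (of_real (bern (Suc j) 0) * pochhammer s j) \<le> ?N" by simp
  qed
  have c: "norm (pochhammer s K * em_sum K s) \<le> ?N * 2"
    unfolding norm_mult by (intro mult_left_mono norm_em_sum assms) auto
  have "riemann_zeta s = em_zeta K s"
    using assms \<open>s \<noteq> 1\<close> by (intro riemann_zeta_em_zeta) auto
  also have "norm \<dots> \<le> norm (1 / (s - 1)) + norm (1/2 :: complex)
     + norm (\<Sum>j=1..<K. of_real (bern (Suc j) 0) * pochhammer s j) + norm (pochhammer s K * em_sum K s)"
    unfolding em_zeta_def by (rule norm_triangle_le_diff add_mono norm_triangle_mono order_refl)+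
  also have "\<dots> \<le> 1 + 1/2 + (real K - 1) * ?N + ?N * 2"
    using a b c assms by (intro add_mono) (auto simp: of_nat_diff)
  also have "\<dots> \<le> (real K + 3) * ?N"
    using one by (simp add: algebra_simps)
  finally show ?thesis .
qed

section \<open>Gamma quotients and the functional equation\<close>

text \<open>Since |w + i| \<ge> i + 1, the shift enlarges the i-th factor at most by 1 + d / (i + 1)
  \<le> exp (d / (i + 1)), and the exponents add up to a harmonic number.\<close>

lemma norm_pochhammer_shift_le:
  fixes w :: complex
  assumes "Re w \<ge> 1" "0 \<le> d"
  shows "norm (pochhammer (w + of_real d) n) \<le> exp (d * harm n) * norm (pochhammer w n)"
proof (induction n)
  case (Suc n)
  have n: "real (Suc n) \<le> norm (w + of_nat n)"
    using complex_Re_le_cmod[of "w + of_nat n"] assms by simp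
  have "norm (w + of_real d + of_nat n) \<le> norm (w + of_nat n) + d"
    using norm_triangle_ineq[of "w + of_nat n" "of_real d"] assms by (simp add: add_ac)
  also have "\<dots> = (1 + d / norm (w + of_nat n)) * norm (w + of_nat n)"
    using n by (auto simp: field_simps)
  also have "\<dots> \<le> (1 + d / real (Suc n)) * norm (w + of_nat n)"
    using n assms by (intro mult_right_mono add_left_mono divide_left_mono mult_pos_pos) auto
  also have "\<dots> \<le> exp (d / real (Suc n)) * norm (w + of_nat n)"
    by (intro mult_right_mono) auto
  finally have "norm (w + of_real d + of_nat n) \<le> exp (d / real (Suc n)) * norm (w + of_nat n)" .
  then have "norm (pochhammer (w + of_real d) (Suc n)) \<le>
      (exp (d * harm n) * norm (pochhammer w n)) * (exp (d / real (Suc n)) * norm (w + of_nat n))"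
    unfolding pochhammer_Suc norm_mult by (intro mult_mono Suc) auto
  also have "\<dots> = exp (d * harm (Suc n)) * norm (pochhammer w (Suc n))"
    by (simp add: harm_Suc pochhammer_Suc norm_mult exp_add distrib_left[of d] divide_inverse)
  finally show ?case .
qed (simp add: harm_def)

text \<open>In Euler's limit for Gamma the shift multiplies the numerator by n powr d and the
  denominator by at most exp (d * harm (n + 1)). As harm (n + 1) \<le> 2 + ln n and d \<le> 1, these
  cancel up to exp 2, uniformly in Im w.\<close>

lemma norm_Gamma_shift_ge:
  fixes w :: complex
  assumes "Re w \<ge> 1" "0 \<le> d" "d \<le> 1"
  shows "norm (Gamma w) \<le> exp 2 * norm (Gamma (w + of_real d))"
proof (rule LIMSEQ_le)
  show "(\<lambda>n. norm (Gamma_series w n)) \<longlonglongrightarrow> norm (Gamma w)"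
    by (intro tendsto_norm Gamma_series_LIMSEQ)
  show "(\<lambda>n. exp 2 * norm (Gamma_series (w + of_real d) n)) \<longlonglongrightarrow> exp 2 * norm (Gamma (w + of_real d))"
    by (intro tendsto_intros Gamma_series_LIMSEQ)
  have "norm (Gamma_series w n) \<le> exp 2 * norm (Gamma_series (w + of_real d) n)" if n: "n \<ge> 1" for n
  proof -
    have norm: "norm (Gamma_series z n) = fact n * exp (Re z * ln (real n)) / norm (pochhammer z (n + 1))"
      for z :: complex
      using n by (simp add: Gamma_series_def norm_mult norm_divide norm_power del: pochhammer_Suc)
    have nz: "pochhammer z (n + 1) \<noteq> 0" if "Re z \<ge> 1" for z :: complex
      using that by (auto simp: pochhammer_eq_0_iff simp del: of_nat_Suc)
    have "harm (n + 1) \<le> ln (real (n + 1)) + (1::real)"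
      using euler_mascheroni_sequence_decreasing[of 1 "n + 1"] by (simp add: harm_def)
    also have "ln (real (n + 1)) = ln (real n) + ln (1 + 1 / real n)"
      using n by (subst ln_mult_pos[symmetric]) (auto simp: distrib_left intro!: add_pos_pos)
    also have "ln (1 + 1 / real n) \<le> 1"
      using n by (intro order_trans[OF ln_add_one_self_le_self]) auto
    finally have "harm (n + 1) \<le> 2 + ln (real n)" by simp
    then have "d * harm (n + 1) \<le> d * (2 + ln (real n))"
      using assms by (intro mult_left_mono)
    also have "\<dots> \<le> 2 + d * ln (real n)"
      using assms by (simp add: ring_distribs)
    finally have le: "d * harm (n + 1) \<le> 2 + d * ln (real n)" .
    have "norm (pochhammer (w + of_real d) (n + 1)) \<le> exp (d * harm (n + 1)) * norm (pochhammer w (n + 1))"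
      by (rule norm_pochhammer_shift_le[OF assms(1,2)])
    also have "\<dots> \<le> exp (2 + d * ln (real n)) * norm (pochhammer w (n + 1))"
      using le by (intro mult_right_mono) auto
    finally have P: "norm (pochhammer (w + of_real d) (n + 1)) \<le> exp (2 + d * ln (real n)) * norm (pochhammer w (n + 1))" .
    have "norm (Gamma_series w n) = fact n * exp (Re w * ln (real n)) * exp (2 + d * ln (real n))
            / (exp (2 + d * ln (real n)) * norm (pochhammer w (n + 1)))"
      unfolding norm by simp
    also have "\<dots> \<le> fact n * exp (Re w * ln (real n)) * exp (2 + d * ln (real n))
            / norm (pochhammer (w + of_real d) (n + 1))"
      using P nz[of "w + of_real d"] nz[of w] assms by (intro divide_left_mono) auto
    also have "\<dots> = exp 2 * norm (Gamma_series (w + of_real d) n)"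
      unfolding norm by (simp add: exp_add ring_distribs)
    finally show ?thesis .
  qed
  then show "\<exists>N. \<forall>n\<ge>N. norm (Gamma_series w n) \<le> exp 2 * norm (Gamma_series (w + of_real d) n)"
    by blast
qed

lemma notin_nonpos_Ints_of_Im: "Im z \<noteq> 0 \<Longrightarrow> z \<notin> \<int>\<^sub>\<le>\<^sub>0"
  by (auto simp: nonpos_Ints_def)

lemma power_over_fact_le_exp: "x \<ge> 0 \<Longrightarrow> x ^ n / fact n \<le> exp (x :: real)"
proof -
  assume x: "x \<ge> 0"
  have s: "(\<lambda>n. x ^ n / fact n) sums exp x"
    using exp_converges[of x] by (simp add: divide_inverse mult.commute)
  have "(\<Sum>k\<in>{n}. x ^ k / fact k) \<le> (\<Sum>k. x ^ k / fact k)"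
    using s x by (intro sum_le_suminf) (auto simp: sums_iff)
  then show ?thesis using s by (simp add: sums_iff)
qed

lemma norm_pochhammer_ge_1:
  assumes "Im z \<ge> 1"
  shows "1 \<le> norm (pochhammer z n)"
proof (induction n)
  case (Suc n)
  have "1 \<le> norm (z + of_nat n)"
    using abs_Im_le_cmod[of "z + of_nat n"] assms by simp
  from mult_mono[OF Suc this] show ?case by (simp add: pochhammer_Suc norm_mult)
qed simp

lemma norm_pochhammer_ge_fact:
  assumes "Re z \<ge> 1"
  shows "fact n \<le> norm (pochhammer z n)"
proof (induction n)
  case (Suc n)
  have "real (Suc n) \<le> norm (z + of_nat n)"
    using complex_Re_le_cmod[of "z + of_nat n"] assms by simp
  from mult_mono[OF Suc this] show ?case by (simp add: pochhammer_Suc norm_mult mult_ac)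
qed simp

text \<open>Corresponding factors differ by 1 + \<mu> \<le> 2, and those on the right have modulus
  at least 1, so each quotient is at most 3. This is how factors from the zeta bound are cancelled
  against factors from the functional equation.\<close>

lemma norm_pochhammer_le_shift:
  assumes "Im s \<ge> 1" "0 \<le> \<mu>" "\<mu> \<le> 1"
  shows "norm (pochhammer (s - 1) n) \<le> 3 ^ n * norm (pochhammer (s + of_real \<mu>) n)"
proof (induction n)
  case (Suc n)
  have "1 \<le> norm (s + of_real \<mu> + of_nat n)"
    using abs_Im_le_cmod[of "s + of_real \<mu> + of_nat n"] assms by simp
  moreover have "norm (s - 1 + of_nat n) \<le> norm (s + of_real \<mu> + of_nat n) + norm (of_real (1 + \<mu>) :: complex)"
    using norm_triangle_ineq4[of "s + of_real \<mu> + of_nat n" "of_real (1 + \<mu>)"]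
    by (simp add: algebra_simps)
  moreover have "norm (of_real (1 + \<mu>) :: complex) \<le> 2"
    unfolding norm_of_real using assms by simp
  ultimately have "norm (s - 1 + of_nat n) \<le> 3 * norm (s + of_real \<mu> + of_nat n)" by linarith
  from mult_mono[OF Suc this] show ?case by (simp add: pochhammer_Suc norm_mult mult_ac)
qed simp

text \<open>Real \<mu> puts all excluded points on the real axis, and absolute values remove
  \<omega> and the conjugation.\<close>

lemma norm_functional_equation:
  assumes "selberg_functional_equation F Q \<omega> 1 (\<lambda>_. 1) (\<lambda>_. of_real \<mu>)" "Im s > 0"
  shows "Q powr Re s * norm (Gamma (s + of_real \<mu>)) * norm (F s) =
    Q powr (1 - Re s) * norm (Gamma (1 - cnj s + of_real \<mu>)) * norm (F (1 - cnj s))"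
proof -
  have Q: "Q > 0" "norm \<omega> = 1" using assms by (auto simp: selberg_functional_equation_def)
  have g: "z \<notin> gamma_poles 1 (\<lambda>_. 1) (\<lambda>_. of_real \<mu>)" if "Im z \<noteq> 0" for z
    using notin_nonpos_Ints_of_Im[of "z + of_real \<mu>"] that by (simp add: gamma_poles_def)
  have "s \<notin> {0, 1}" using assms by auto
  then have "completed F Q 1 (\<lambda>_. 1) (\<lambda>_. of_real \<mu>) s
      = \<omega> * cnj (completed F Q 1 (\<lambda>_. 1) (\<lambda>_. of_real \<mu>) (1 - cnj s))"
    using assms g[of s] g[of "1 - cnj s"] unfolding selberg_functional_equation_def by (simp del: insert_iff)
  then have "norm (completed F Q 1 (\<lambda>_. 1) (\<lambda>_. of_real \<mu>) s)
      = norm (completed F Q 1 (\<lambda>_. 1) (\<lambda>_. of_real \<mu>) (1 - cnj s))"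
    using Q by (simp add: norm_mult)
  then show ?thesis
    using Q by (simp add: completed_def norm_mult norm_powr_real_powr)
qed

text \<open>The Gamma arguments s + \<mu> and 1 - cnj s + \<mu> have equal imaginary parts and
  distance 1 - 2 Re s. The integer part \<open>m\<close> of this distance is crossed exactly by the
  recurrence of Gamma, the rest \<open>d\<close> by \<open>norm_Gamma_shift_ge\<close>.\<close>

lemma functional_equation_lower_bound:
  assumes FE: "selberg_functional_equation F Q \<omega> 1 (\<lambda>_. 1) (\<lambda>_. of_real \<mu>)"
    and \<mu>: "0 \<le> \<mu>" and s: "Re s \<le> -1" "Im s \<ge> 1"
  shows "norm (F (1 - cnj s)) * norm (pochhammer (s + of_real \<mu>) (nat \<lfloor>1 - 2 * Re s\<rfloor>))
      \<le> exp 2 * Q powr (2 * Re s - 1) * norm (F s)"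
proof -
  define m where "m = nat \<lfloor>1 - 2 * Re s\<rfloor>"
  define d where "d = 1 - 2 * Re s - real m"
  define z where "z = s + of_real \<mu>"
  have Q: "Q > 0" using FE by (auto simp: selberg_functional_equation_def)
  have m: "real m = of_int \<lfloor>1 - 2 * Re s\<rfloor>" using s by (simp add: m_def)
  have d: "0 \<le> d" "d \<le> 1" unfolding d_def m by linarith+
  have zn: "z \<notin> \<int>\<^sub>\<le>\<^sub>0" using s by (intro notin_nonpos_Ints_of_Im) (simp add: z_def)
  then have G0: "Gamma z \<noteq> 0" by (simp add: Gamma_eq_zero_iff)
  have eq: "1 - cnj s + of_real \<mu> = (z + of_nat m) + of_real d"
    by (simp add: complex_eq_iff d_def z_def)
  have "Gamma (z + of_nat m) = pochhammer z m * Gamma z"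
    using pochhammer_Gamma[OF zn, of m] G0 by simp
  moreover have "norm (Gamma (z + of_nat m)) \<le> exp 2 * norm (Gamma (1 - cnj s + of_real \<mu>))"
    unfolding eq
  proof (rule norm_Gamma_shift_ge)
    \<comment> \<open>Here Re (z + m) = 1 - Re s + \<mu> - d, and Re s \<le> -1 makes it at least
      1.\<close>
    have "real m = 1 - 2 * Re s - d" by (simp add: d_def)
    then show "1 \<le> Re (z + of_nat m)" using s \<mu> d by (simp add: z_def)
  qed (use d in auto)
  ultimately have 1: "norm (pochhammer z m) * norm (Gamma z) \<le> exp 2 * norm (Gamma (1 - cnj s + of_real \<mu>))"
    by (simp add: norm_mult)
  have fe: "Q powr Re s * norm (Gamma z) * norm (F s) =
    Q powr (1 - Re s) * norm (Gamma (1 - cnj s + of_real \<mu>)) * norm (F (1 - cnj s))"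
    using norm_functional_equation[OF FE, of s] s by (simp add: z_def)
  have Qe: "Q powr Re s = Q powr (1 - Re s) * Q powr (2 * Re s - 1)"
    using Q by (simp flip: powr_add)
  have fe': "norm (Gamma (1 - cnj s + of_real \<mu>)) * norm (F (1 - cnj s))
      = Q powr (2 * Re s - 1) * norm (Gamma z) * norm (F s)"
    using fe Q unfolding Qe by simp
  have "norm (Gamma z) * (norm (F (1 - cnj s)) * norm (pochhammer z m))
      = norm (pochhammer z m) * norm (Gamma z) * norm (F (1 - cnj s))" by simp
  also have "\<dots> \<le> exp 2 * norm (Gamma (1 - cnj s + of_real \<mu>)) * norm (F (1 - cnj s))"
    by (intro mult_right_mono 1) auto
  also have "\<dots> = norm (Gamma z) * (exp 2 * Q powr (2 * Re s - 1) * norm (F s))"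
    using fe' by simp
  finally show ?thesis using G0 by (simp add: z_def m_def)
qed

text \<open>The functional equation gives about \<open>2 |\<sigma>|\<close> linear factors in the denominator, while zeta costs only
  about \<open>|\<sigma>|\<close> of them; the surplus is at least a factorial of \<open>|\<sigma>| - O(1)\<close>, uniformly in \<open>Im s\<close>.\<close>

lemma zeta_over_F_decay:
  assumes FE: "selberg_functional_equation F Q \<omega> 1 (\<lambda>_. 1) (\<lambda>_. of_real \<mu>)"
    and \<mu>: "0 \<le> \<mu>" "\<mu> < 1"
  shows "\<exists>C>0. \<forall>s. Re s \<le> -6 \<longrightarrow> Im s \<ge> 1 \<longrightarrow>
     norm (riemann_zeta (s - 1)) * norm (F (1 - cnj s)) \<le> C * exp (E * Re s) * norm (F s)"
proof -
  have Q: "Q > 0" using FE by (auto simp: selberg_functional_equation_def)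
  \<comment> \<open>Bounds 1 / Q and is at least 1, so its powers increase with the
    exponent.\<close>
  define q where "q = max 1 (1 / Q)"
  have q: "q \<ge> 1" by (simp add: q_def)
  define A where "A = 6 * q^2 * exp \<bar>E\<bar>"
  define C where "C = exp 2 * (4 * 6 ^ 8 * q ^ 9 * exp (4 * \<bar>E\<bar>)) * exp A"
  have "C > 0" using q by (auto simp: C_def)
  moreover have "norm (riemann_zeta (s - 1)) * norm (F (1 - cnj s)) \<le> C * exp (E * Re s) * norm (F s)"
    if s: "Re s \<le> -6" "Im s \<ge> 1" for s
  proof -
    define \<sigma> where "\<sigma> = Re s"
    \<comment> \<open>The smallest order with Re (s - 1) + K \<ge> 2, as the zeta bound
      demands.\<close>
    define K where "K = nat \<lceil>3 - \<sigma>\<rceil>"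
    define m where "m = nat \<lfloor>1 - 2 * \<sigma>\<rfloor>"
    \<comment> \<open>The number of linear factors left after \<open>K\<close> of them have been
      spent on zeta; it exceeds -\<sigma> - 4.\<close>
    define N where "N = m - K"
    define z where "z = s + of_real \<mu>"
    have "real m = of_int \<lfloor>1 - 2 * \<sigma>\<rfloor>" using s by (simp add: m_def \<sigma>_def)
    then have m: "real m > - 2 * \<sigma>" by linarith
    have "real K = of_int \<lceil>3 - \<sigma>\<rceil>" using s by (simp add: K_def \<sigma>_def)
    then have K: "real K < 4 - \<sigma>" "real K \<ge> 3 - \<sigma>" by linarith+
    have "real K < real m" using m K s by (simp add: \<sigma>_def)
    then have mK: "K \<le> m" by simp
    then have N: "- \<sigma> < real N + 4" using m K by (simp add: N_def of_nat_diff)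
    then have KN: "K \<le> N + 8" using K by linarith
    have zeta: "norm (riemann_zeta (s - 1)) \<le> (real K + 3) * norm (pochhammer (s - 1) K)"
      using s K by (intro norm_riemann_zeta_le) (auto simp: \<sigma>_def)
    also have "\<dots> \<le> (real K + 3) * (3 ^ K * norm (pochhammer z K))"
      unfolding z_def using s \<mu> by (intro mult_left_mono norm_pochhammer_le_shift) auto
    finally have zeta: "norm (riemann_zeta (s - 1)) \<le> (real K + 3) * 3 ^ K * norm (pochhammer z K)" by simp
    \<comment> \<open>The first \<open>K\<close> factors compensate zeta; the other \<open>N\<close>
      start at a point of real part at least 3 and supply a factorial.\<close>
    have "pochhammer z m = pochhammer z K * pochhammer (z + of_nat K) N"
      using pochhammer_product[OF mK, of z] by (simp add: N_def)
    moreover have "fact N \<le> norm (pochhammer (z + of_nat K) N)"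
      using K s \<mu> by (intro norm_pochhammer_ge_fact) (auto simp: z_def \<sigma>_def)
    ultimately have poch: "norm (pochhammer z K) * fact N \<le> norm (pochhammer z m)"
      by (auto simp: norm_mult intro!: mult_left_mono)
    have fe: "norm (F (1 - cnj s)) * norm (pochhammer z m) \<le> exp 2 * Q powr (2 * \<sigma> - 1) * norm (F s)"
      using functional_equation_lower_bound[OF FE \<mu>(1), of s] s by (simp add: z_def m_def \<sigma>_def)
    have "fact N * (norm (riemann_zeta (s - 1)) * norm (F (1 - cnj s)))
       \<le> fact N * ((real K + 3) * 3 ^ K * norm (pochhammer z K) * norm (F (1 - cnj s)))"
      by (intro mult_left_mono mult_right_mono zeta) auto
    also have "\<dots> = (real K + 3) * 3 ^ K * norm (F (1 - cnj s)) * (norm (pochhammer z K) * fact N)"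
      by simp
    also have "\<dots> \<le> (real K + 3) * 3 ^ K * norm (F (1 - cnj s)) * norm (pochhammer z m)"
      by (intro mult_left_mono poch) auto
    also have "\<dots> = (real K + 3) * 3 ^ K * (norm (F (1 - cnj s)) * norm (pochhammer z m))"
      by simp
    also have "\<dots> \<le> (real K + 3) * 3 ^ K * (exp 2 * Q powr (2 * \<sigma> - 1) * norm (F s))"
      by (intro mult_left_mono fe) auto
    \<comment> \<open>Everything is expressed through \<open>N\<close>, using K \<le> N + 8 and 1 -
      2 \<sigma> < 2 N + 9, so that only an N-th power of a constant stands against
      \<open>fact N\<close>.\<close>
    also have "\<dots> \<le> (4 * 6 ^ (N + 8)) * (exp 2 * q ^ (2 * N + 9) * norm (F s))"
    proof -
      have "real K + 3 \<le> 4 * 2 ^ K"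
      proof -
        have "real K \<le> 2 ^ K" using of_nat_less_two_power[of K, where 'a = real] by simp
        moreover have "(1::real) \<le> 2 ^ K" by simp
        ultimately show ?thesis by linarith
      qed
      then have "(real K + 3) * 3 ^ K \<le> (4 * 2 ^ K) * 3 ^ K" by (intro mult_right_mono) auto
      also have "\<dots> = 4 * 6 ^ K" by (simp flip: power_mult_distrib)
      also have "\<dots> \<le> 4 * 6 ^ (N + 8)" using KN by (intro mult_left_mono power_increasing) auto
      finally have 1: "(real K + 3) * 3 ^ K \<le> 4 * 6 ^ (N + 8)" .
      have "Q powr (2 * \<sigma> - 1) = (1 / Q) powr (1 - 2 * \<sigma>)"
        using Q by (simp add: powr_divide powr_minus_divide[symmetric])
      also have "\<dots> \<le> q powr (1 - 2 * \<sigma>)"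
        using Q s by (intro powr_mono2) (auto simp: q_def \<sigma>_def)
      also have "\<dots> \<le> q powr (real (2 * N + 9))"
        using q N by (intro powr_mono) auto
      also have "\<dots> = q ^ (2 * N + 9)" using q by (intro powr_realpow) auto
      finally have 2: "Q powr (2 * \<sigma> - 1) \<le> q ^ (2 * N + 9)" .
      show ?thesis
        by (rule mult_mono[OF 1 mult_right_mono[OF mult_left_mono[OF 2]]]) auto
    qed
    also have "\<dots> = exp 2 * (4 * 6 ^ 8 * q ^ 9) * (6 * q^2) ^ N * norm (F s)"
      by (simp add: power_add power_mult_distrib mult_ac flip: power_mult)
    finally have "norm (riemann_zeta (s - 1)) * norm (F (1 - cnj s))
       \<le> exp 2 * (4 * 6 ^ 8 * q ^ 9) * ((6 * q^2) ^ N / fact N) * norm (F s)"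
      by (simp add: field_simps)
    also have "\<dots> = exp 2 * (4 * 6 ^ 8 * q ^ 9) * (exp (- E * \<sigma>) * ((6 * q^2) ^ N / fact N)) * exp (E * \<sigma>) * norm (F s)"
      by (simp flip: exp_add)
    \<comment> \<open>Extracting exp (E \<sigma>) costs at most exp (|E| (N + 4)), again an N-th
      power up to a constant. The base becomes \<open>A\<close>, and A ^ N / fact N \<le> exp
      A.\<close>
    also have "\<dots> \<le> exp 2 * (4 * 6 ^ 8 * q ^ 9) * (exp (4 * \<bar>E\<bar>) * exp A) * exp (E * \<sigma>) * norm (F s)"
    proof (intro mult_right_mono mult_left_mono)
      have "- E * \<sigma> \<le> \<bar>E\<bar> * - \<sigma>"
        using s by (simp add: \<sigma>_def mult_right_mono_neg)
      also have "\<dots> \<le> \<bar>E\<bar> * (real N + 4)" using N by (intro mult_left_mono) auto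
      finally have "exp (- E * \<sigma>) \<le> exp (\<bar>E\<bar> * (real N + 4))" by simp
      then have "exp (- E * \<sigma>) \<le> exp (4 * \<bar>E\<bar>) * exp \<bar>E\<bar> ^ N"
        by (simp add: exp_add ring_distribs mult_ac flip: exp_of_nat_mult)
      then have "exp (- E * \<sigma>) * ((6 * q^2) ^ N / fact N) \<le> (exp (4 * \<bar>E\<bar>) * exp \<bar>E\<bar> ^ N) * ((6 * q^2) ^ N / fact N)"
        using q by (intro mult_right_mono) auto
      also have "\<dots> = exp (4 * \<bar>E\<bar>) * (A ^ N / fact N)"
        by (simp add: A_def power_mult_distrib mult_ac)
      also have "\<dots> \<le> exp (4 * \<bar>E\<bar>) * exp A"
        using q by (intro mult_left_mono power_over_fact_le_exp) (auto simp: A_def)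
      finally show "exp (- E * \<sigma>) * ((6 * q^2) ^ N / fact N) \<le> exp (4 * \<bar>E\<bar>) * exp A" .
    qed (use q in auto)
    finally show ?thesis by (simp add: C_def \<sigma>_def mult_ac)
  qed
  ultimately show ?thesis by blast
qed

section \<open>Expansion of the quotient in a general Dirichlet series\<close>

lemma has_sum_Times_mult:
  fixes f :: "'a \<Rightarrow> complex" and g :: "'b \<Rightarrow> complex"
  assumes f: "(\<lambda>x. norm (f x)) summable_on A" and g: "(\<lambda>y. norm (g y)) summable_on B"
  shows "(\<lambda>(x, y). norm (f x * g y)) summable_on A \<times> B"
    and "((\<lambda>(x, y). f x * g y) has_sum (infsum f A * infsum g B)) (A \<times> B)"
proof -
  have "(\<lambda>p. norm ((\<lambda>(x, y). f x * g y) p)) summable_on A \<times> B"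
  proof (subst Infinite_Sum.abs_summable_on_Sigma_iff, intro conjI ballI)
    fix x
    show "(\<lambda>y. norm (case (x, y) of (x, y) \<Rightarrow> f x * g y)) summable_on B"
      using g by (auto simp: norm_mult intro!: summable_on_cmult_right)
  next
    have "(\<lambda>x. norm (f x) * infsum (\<lambda>y. norm (g y)) B) summable_on A"
      by (intro summable_on_cmult_left f)
    moreover have "\<bar>infsum (\<lambda>y. norm (g y)) B\<bar> = infsum (\<lambda>y. norm (g y)) B"
      by (intro abs_of_nonneg infsum_nonneg) auto
    ultimately show "(\<lambda>x. norm (\<Sum>\<^sub>\<infinity>y\<in>B. norm (case (x, y) of (x, y) \<Rightarrow> f x * g y))) summable_on A"
      by (simp add: norm_mult infsum_cmult_right' abs_mult)
  qed
  then show sm: "(\<lambda>(x, y). norm (f x * g y)) summable_on A \<times> B"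
    by (simp add: case_prod_unfold)
  show "((\<lambda>(x, y). f x * g y) has_sum (infsum f A * infsum g B)) (A \<times> B)"
  proof (rule has_sum_SigmaI)
    fix x
    show "((\<lambda>y. case (x, y) of (x, y) \<Rightarrow> f x * g y) has_sum f x * infsum g B) B"
      using abs_summable_summable[OF g] by (auto intro!: has_sum_cmult_right has_sum_infsum)
  next
    show "((\<lambda>x. f x * infsum g B) has_sum infsum f A * infsum g B) A"
      using abs_summable_summable[OF f] by (auto intro!: has_sum_cmult_left has_sum_infsum)
  next
    show "(\<lambda>(x, y). f x * g y) summable_on A \<times> B"
      using sm by (subst abs_summable_summable) (simp_all add: case_prod_unfold)
  qed
qed

text \<open>Splitting off the head gives a (N + 1) = 1 + sum f Y * a N for the sums a N, and 1 / (1
  - S) is the fixed point of x -> 1 + S x.\<close>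

lemma sum_prod_list_le:
  fixes f :: "'a \<Rightarrow> real"
  assumes "finite Y" "\<And>y. y \<in> Y \<Longrightarrow> f y \<ge> 0" "sum f Y \<le> S" "S < 1"
  shows "(\<Sum>xs | set xs \<subseteq> Y \<and> length xs \<le> N. prod_list (map f xs)) \<le> 1 / (1 - S)"
proof (induction N)
  case 0
  have "0 \<le> S" using sum_nonneg[of Y f] assms by auto
  have "{xs. set xs \<subseteq> Y \<and> length xs \<le> 0} = {[]}" by auto
  then show ?case using assms \<open>0 \<le> S\<close> by (simp add: field_simps)
next
  case (Suc N)
  let ?L = "\<lambda>N. {xs. set xs \<subseteq> Y \<and> length xs \<le> N}"
  have S0: "0 \<le> S" using sum_nonneg[of Y f] assms by auto
  have fin: "finite (?L N)" for N by (rule finite_lists_length_le[OF assms(1)])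
  have eq: "?L (Suc N) = insert [] ((\<lambda>(x, xs). x # xs) ` (Y \<times> ?L N))"
  proof (rule Set.set_eqI, rule iffI)
    fix xs assume "xs \<in> ?L (Suc N)"
    then show "xs \<in> insert [] ((\<lambda>(x, xs). x # xs) ` (Y \<times> ?L N))"
      by (cases xs) auto
  qed auto
  have inj: "inj_on (\<lambda>(x, xs). x # xs) (Y \<times> ?L N)" by (auto simp: inj_on_def)
  have "(\<Sum>xs\<in>?L (Suc N). prod_list (map f xs))
      = 1 + (\<Sum>(x, xs)\<in>Y \<times> ?L N. f x * prod_list (map f xs))"
  proof -
    have "(\<Sum>xs\<in>(\<lambda>(x, xs). x # xs) ` (Y \<times> ?L N). prod_list (map f xs))
        = (\<Sum>(x, xs)\<in>Y \<times> ?L N. f x * prod_list (map f xs))"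
      by (subst sum.reindex[OF inj]) (simp add: o_def case_prod_unfold)
    then show ?thesis
      unfolding eq using fin assms(1) by (subst sum.insert) auto
  qed
  also have "\<dots> = 1 + sum f Y * (\<Sum>xs\<in>?L N. prod_list (map f xs))"
    by (simp add: sum.cartesian_product sum_product)
  also have "\<dots> \<le> 1 + S * (1 / (1 - S))"
  proof (intro add_left_mono mult_mono Suc assms(3) S0 sum_nonneg)
    fix xs assume "xs \<in> ?L N"
    then show "0 \<le> prod_list (map f xs)" using assms(2) by (intro prod_list_nonneg) auto
  qed
  also have "\<dots> = 1 / (1 - S)" using assms(4) by (simp add: field_simps)
  finally show ?case .
qed

text \<open>The geometric series multiplied out over words. Its value \<open>T\<close> follows from
  splitting off the first letter: T = 1 + infsum f X * T.\<close>

lemma geometric_sum_lists: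
  fixes f :: "'a \<Rightarrow> complex"
  assumes f: "(\<lambda>x. norm (f x)) summable_on X" and S: "infsum (\<lambda>x. norm (f x)) X < 1"
  shows "(\<lambda>xs. norm (prod_list (map f xs))) summable_on lists X"
    and "((\<lambda>xs. prod_list (map f xs)) has_sum (1 / (1 - infsum f X))) (lists X)"
proof -
  let ?S = "infsum (\<lambda>x. norm (f x)) X"
  have norm: "norm (prod_list (map f xs)) = prod_list (map (\<lambda>x. norm (f x)) xs)" for xs
    by (induction xs) (auto simp: norm_mult)
  show sm: "(\<lambda>xs. norm (prod_list (map f xs))) summable_on lists X"
  proof (rule nonneg_bdd_above_summable_on)
    show "bdd_above (sum (\<lambda>xs. norm (prod_list (map f xs))) ` {F. F \<subseteq> lists X \<and> finite F})"
    proof (rule bdd_aboveI2)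
      fix Fs assume "Fs \<in> {F. F \<subseteq> lists X \<and> finite F}"
      then have Fs: "Fs \<subseteq> lists X" "finite Fs" by auto
      \<comment> \<open>A finite set of words uses finitely many letters and has bounded length, so
        the finite estimate applies.\<close>
      define Y where "Y = (\<Union>xs\<in>Fs. set xs)"
      define N where "N = Max (insert 0 (length ` Fs))"
      have Y: "finite Y" "Y \<subseteq> X" using Fs by (auto simp: Y_def)
      have "Fs \<subseteq> {xs. set xs \<subseteq> Y \<and> length xs \<le> N}"
        using Fs by (auto simp: Y_def N_def)
      then have "(\<Sum>xs\<in>Fs. norm (prod_list (map f xs)))
         \<le> (\<Sum>xs | set xs \<subseteq> Y \<and> length xs \<le> N. norm (prod_list (map f xs)))"
        using finite_lists_length_le[OF Y(1)] by (intro sum_mono2) auto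
      also have "\<dots> \<le> 1 / (1 - ?S)"
        unfolding norm
      proof (rule sum_prod_list_le)
        show "(\<Sum>y\<in>Y. norm (f y)) \<le> ?S"
          using Y f by (intro finite_sum_le_infsum) auto
      qed (use Y S in auto)
      finally show "(\<Sum>xs\<in>Fs. norm (prod_list (map f xs))) \<le> 1 / (1 - ?S)" .
    qed
  qed auto
  define T where "T = infsum (\<lambda>xs. prod_list (map f xs)) (lists X)"
  have sm': "(\<lambda>xs. prod_list (map f xs)) summable_on lists X"
    using sm by (rule abs_summable_summable)
  have inj: "inj_on (\<lambda>(x, xs). x # xs) (X \<times> lists X)" by (auto simp: inj_on_def)
  have eq: "lists X = insert [] ((\<lambda>(x, xs). x # xs) ` (X \<times> lists X))"
  proof (rule Set.set_eqI, rule iffI)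
    fix xs assume "xs \<in> lists X"
    then show "xs \<in> insert [] ((\<lambda>(x, xs). x # xs) ` (X \<times> lists X))"
      by (cases xs) auto
  qed auto
  have "((\<lambda>(x, xs). f x * prod_list (map f xs)) has_sum (infsum f X * T)) (X \<times> lists X)"
    unfolding T_def by (rule has_sum_Times_mult[OF f sm])
  then have "((\<lambda>xs. prod_list (map f xs)) has_sum (infsum f X * T)) ((\<lambda>(x, xs). x # xs) ` (X \<times> lists X))"
    by (subst has_sum_reindex[OF inj]) (simp add: o_def case_prod_unfold)
  from has_sum_insert[OF _ this, of "[]"]
  have "((\<lambda>xs. prod_list (map f xs)) has_sum (1 + infsum f X * T)) (insert [] ((\<lambda>(x, xs). x # xs) ` (X \<times> lists X)))"
    by force
  then have "((\<lambda>xs. prod_list (map f xs)) has_sum (1 + infsum f X * T)) (lists X)"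
    by (simp only: eq[symmetric])
  from infsumI[OF this] have T: "T = 1 + infsum f X * T" by (simp only: T_def[symmetric])
  have "norm (infsum f X) < 1"
    using norm_infsum_bound[OF f] S by simp
  then have "infsum f X \<noteq> 1" by auto
  then have "T = 1 / (1 - infsum f X)"
    using T by (simp add: field_simps)
  then show "((\<lambda>xs. prod_list (map f xs)) has_sum (1 / (1 - infsum f X))) (lists X)"
    using has_sum_infsum[OF sm'] by (simp only: T_def[symmetric])
qed

section \<open>The quotient zeta (s - 1) / F s as a sum over pairs of a number and a word\<close>

lemma nat_powr_eq_exp: "n \<ge> 1 \<Longrightarrow> of_nat n powr (- s) = exp (- of_real (ln (real n)) * (s :: complex))"
  by (simp add: powr_def Ln_of_nat mult.commute)

lemma prod_list_mult_exp:
  "prod_list (map (\<lambda>n. b n * exp (- of_real (l n) * s)) xs) =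
     prod_list (map b xs) * exp (- of_real (sum_list (map l xs)) * (s :: complex))"
  by (induction xs) (auto simp: exp_add exp_minus ring_distribs exp_diff divide_inverse)

text \<open>With \<open>m\<close> the first index of a nonzero coefficient, \<open>F s\<close> is its leading term times \<open>1 - b\<close> with \<open>b\<close> small,
  and expanding the geometric series without collecting equal products leads to sums over lists.\<close>

lemma dirichlet_quotient_expansion:
  fixes a :: "nat \<Rightarrow> complex" and F :: "complex \<Rightarrow> complex"
  assumes sm: "\<And>s. Re s > 1 \<Longrightarrow> (\<lambda>n. norm (a n * of_nat n powr (- s))) summable_on {1..}"
    and F: "\<And>s. Re s > 1 \<Longrightarrow> F s = (\<Sum>\<^sub>\<infinity>n\<in>{1..}. a n * of_nat n powr (- s))"
    and nz: "F 2 \<noteq> 0"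
  obtains A M B :: real and I :: "(nat \<times> nat list) set" and c :: "nat \<times> nat list \<Rightarrow> complex"
      and l :: "nat \<times> nat list \<Rightarrow> real"
  where "A > 2" "B > 0" "\<And>s. Re s \<ge> A \<Longrightarrow> norm (F s) \<ge> B * exp (- M * Re s)"
    "(\<lambda>i. norm (c i) * exp (- A * l i)) summable_on I"
    "\<And>L. finite {i\<in>I. l i \<le> L}"
    "\<And>s. Re s = A \<Longrightarrow> ((\<lambda>i. c i * exp (- of_real (l i) * s)) has_sum (riemann_zeta (s - 1) / F s)) I"
proof -
  have "\<exists>n\<ge>1. a n \<noteq> 0"
  proof (rule ccontr)
    assume "\<not> (\<exists>n\<ge>1. a n \<noteq> 0)"
    then have "F 2 = (\<Sum>\<^sub>\<infinity>n\<in>{1::nat..}. 0)"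
      by (subst F) (auto intro!: infsum_0)
    then show False using nz by simp
  qed
  define m where "m = (LEAST n. n \<ge> 1 \<and> a n \<noteq> 0)"
  have m: "m \<ge> 1" "a m \<noteq> 0"
    using LeastI_ex[of "\<lambda>n. n \<ge> 1 \<and> a n \<noteq> 0"] \<open>\<exists>n\<ge>1. a n \<noteq> 0\<close> by (auto simp: m_def)
  have less_m: "a n = 0" if "n \<ge> 1" "n < m" for n
    using not_less_Least[of n "\<lambda>n. n \<ge> 1 \<and> a n \<noteq> 0"] that by (auto simp: m_def)
  define b where "b = (\<lambda>n. - (a n / a m))"
  define lam where "lam = (\<lambda>n. ln (real n) - ln (real m))"
  define f where "f = (\<lambda>s n. b n * exp (- of_real (lam n) * s))"
  \<comment> \<open>The smallest exponent occurring in the tail. Its positivity makes the tail small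
    for large Re s and later bounds the lengths of words.\<close>
  define lam1 where "lam1 = lam (Suc m)"
  have lam1: "lam1 > 0" using m by (simp add: lam1_def lam_def)
  have lam_ge: "lam n \<ge> lam1" if "n > m" for n
    using that m by (simp add: lam1_def lam_def)
  have f_eq: "a n * of_nat n powr (- s) = - a m * exp (- of_real (ln (real m)) * s) * f s n"
    if "n > m" for n s
    using that m nat_powr_eq_exp[of n s]
    by (simp add: f_def b_def lam_def left_diff_distrib exp_diff exp_minus field_simps)
  have f_sm: "(\<lambda>n. norm (f s n)) summable_on {m<..}" if "Re s > 1" for s
  proof -
    have "(\<lambda>n. norm (a n * of_nat n powr (- s))) summable_on {m<..}"
      using sm[OF that] by (rule summable_on_subset_banach) auto
    also have "?this \<longleftrightarrow> (\<lambda>n. norm (- a m * exp (- of_real (ln (real m)) * s)) * norm (f s n)) summable_on {m<..}"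
      by (intro summable_on_cong) (simp only: f_eq norm_mult greaterThan_iff)
    finally have "(\<lambda>n. inverse (norm (- a m * exp (- of_real (ln (real m)) * s)))
        * (norm (- a m * exp (- of_real (ln (real m)) * s)) * norm (f s n))) summable_on {m<..}"
      by (rule summable_on_cmult_right)
    then show ?thesis using m by (simp flip: mult.assoc)
  qed
  have F_eq: "F s = a m * exp (- of_real (ln (real m)) * s) * (1 - infsum (f s) {m<..})" if s: "Re s > 1" for s
  proof -
    have "F s = (\<Sum>\<^sub>\<infinity>n\<in>insert m {m<..}. a n * of_nat n powr (- s))"
      unfolding F[OF s] by (rule infsum_cong_neutral) (use m less_m in \<open>auto simp: not_less\<close>)
    also have "\<dots> = a m * of_nat m powr (- s) + (\<Sum>\<^sub>\<infinity>n\<in>{m<..}. a n * of_nat n powr (- s))"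
    proof (rule infsum_insert)
      show "(\<lambda>n. a n * of_nat n powr (- s)) summable_on {m<..}"
        using abs_summable_summable[OF sm[OF s]] by (rule summable_on_subset_banach) auto
    qed auto
    also have "(\<Sum>\<^sub>\<infinity>n\<in>{m<..}. a n * of_nat n powr (- s))
        = - a m * exp (- of_real (ln (real m)) * s) * infsum (f s) {m<..}"
      using f_eq by (subst infsum_cmult_right'[symmetric]) (auto intro!: infsum_cong)
    finally show ?thesis using nat_powr_eq_exp[of m s] m by (simp add: algebra_simps)
  qed
  define S where "S = infsum (\<lambda>n. norm (f 2 n)) {m<..}"
  have S0: "S \<ge> 0" unfolding S_def by (rule infsum_nonneg) auto
  \<comment> \<open>Moving from real part 2 to Re s gains at least exp (- lam1 (Re s - 2)) in every
    term.\<close>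
  have S_le: "infsum (\<lambda>n. norm (f s n)) {m<..} \<le> exp (- lam1 * (Re s - 2)) * S" if s: "Re s \<ge> 2" for s
    unfolding S_def infsum_cmult_right'[symmetric]
  proof (rule infsum_mono)
    show "(\<lambda>n. norm (f s n)) summable_on {m<..}" "(\<lambda>n. exp (- lam1 * (Re s - 2)) * norm (f 2 n)) summable_on {m<..}"
      using s f_sm by (auto intro!: summable_on_cmult_right)
    fix n assume n: "n \<in> {m<..}"
    have "lam1 * (Re s - 2) \<le> lam n * (Re s - 2)"
      using lam_ge[of n] n s by (intro mult_right_mono) auto
    then have "exp (- lam n * Re s) \<le> exp (- lam1 * (Re s - 2)) * exp (- lam n * 2)"
      by (simp add: algebra_simps flip: exp_add)
    then show "norm (f s n) \<le> exp (- lam1 * (Re s - 2)) * norm (f 2 n)"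
      by (simp add: f_def norm_mult mult_left_mono mult_ac)
  qed
  \<comment> \<open>The second entry gives exp (- lam1 (A - 2)) \<le> 1 / (2 S + 1), so the tail is
    at most S / (2 S + 1) \<le> 1/2. The 3 ensures A > 2, where the series of zeta (s - 1) converges
    absolutely.\<close>
  define A where "A = max 3 (2 + ln (2 * S + 1) / lam1)"
  have A: "A > 2" by (simp add: A_def)
  have S_half: "infsum (\<lambda>n. norm (f s n)) {m<..} \<le> 1/2" if "Re s \<ge> A" for s
  proof -
    have "ln (2 * S + 1) / lam1 \<le> Re s - 2" using that by (simp add: A_def)
    then have "ln (2 * S + 1) \<le> lam1 * (Re s - 2)"
      using lam1 by (simp add: field_simps)
    then have "exp (- lam1 * (Re s - 2)) \<le> exp (- ln (2 * S + 1))" by simp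
    also have "\<dots> = 1 / (2 * S + 1)" using S0 by (simp add: exp_minus field_simps)
    finally have "exp (- lam1 * (Re s - 2)) * S \<le> 1 / (2 * S + 1) * S"
      using S0 by (intro mult_right_mono) auto
    also have "\<dots> \<le> 1/2" using S0 by (simp add: field_simps)
    finally show ?thesis using S_le[of s] that A by linarith
  qed
  have F_lower: "norm (F s) \<ge> norm (a m) / 2 * exp (- ln (real m) * Re s)" if s: "Re s \<ge> A" for s
  proof -
    have "norm (infsum (f s) {m<..}) \<le> 1/2"
      using norm_infsum_bound[OF f_sm[of s]] S_half[OF s] s A by simp
    then have "norm (1 - infsum (f s) {m<..}) \<ge> 1/2"
      using norm_triangle_ineq2[of 1 "infsum (f s) {m<..}"] by simp
    then have "norm (a m) * exp (- ln (real m) * Re s) * (1/2)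
      \<le> norm (a m) * exp (- ln (real m) * Re s) * norm (1 - infsum (f s) {m<..})"
      by (intro mult_left_mono) auto
    then show ?thesis using s A F_eq[of s] by (simp add: norm_mult)
  qed
  define I where "I = {1::nat..} \<times> lists {m<..}"
  define c where "c = (\<lambda>(k, xs). of_nat k / a m * prod_list (map b xs))"
  \<comment> \<open>Exponents of the three factors: k from zeta, m from division by the leading
    term, the word from the geometric series. Different indices may share an exponent, and it can be
    negative.\<close>
  define l where "l = (\<lambda>(k, xs). ln (real k) - ln (real m) + sum_list (map lam xs))"
  have term_eq: "c i * exp (- of_real (l i) * s) =
      exp (of_real (ln (real m)) * s) / a m *
      (case i of (k, xs) \<Rightarrow> of_nat k powr (- (s - 1)) * prod_list (map (f s) xs))" if "i \<in> I" for i s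
  proof -
    obtain k xs where i: "i = (k, xs)" by (cases i)
    then have k: "k \<ge> 1" using that by (auto simp: I_def)
    then have pk: "of_nat k powr (- (s - 1)) = of_nat k * exp (- of_real (ln (real k)) * s)"
      using powr_add[of "of_nat k" 1 "- s"] nat_powr_eq_exp[OF k, of s] by simp
    show ?thesis
      unfolding i case_prod_conv f_def prod_list_mult_exp pk
      by (simp add: c_def l_def ring_distribs exp_add exp_diff exp_minus field_simps)
  qed
  have geo: "(\<lambda>xs. norm (prod_list (map (f s) xs))) summable_on lists {m<..}"
     "((\<lambda>xs. prod_list (map (f s) xs)) has_sum (1 / (1 - infsum (f s) {m<..}))) (lists {m<..})"
     if "Re s \<ge> A" for s
    using geometric_sum_lists[OF f_sm, of s] S_half[of s] that A by auto
  have zsm: "(\<lambda>k::nat. norm (of_nat k powr (- (s - 1)) :: complex)) summable_on {1..}" if "Re s > 2" for s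
  proof -
    have "(\<lambda>k::nat. real k powr (- (Re s - 1))) summable_on {1..}"
      using that by (intro summable_on_nat_powr) auto
    then show ?thesis
      by (rule summable_on_cong[THEN iffD1, rotated]) (use norm_nat_add_powr[of _ 0 "- (s - 1)"] in auto)
  qed
  show ?thesis
  proof (rule that[of A "norm (a m) / 2" "ln (real m)" c l I])
    show "A > 2" "norm (a m) / 2 > 0" using A m by auto
    show "norm (F s) \<ge> norm (a m) / 2 * exp (- ln (real m) * Re s)" if "Re s \<ge> A" for s
      by (rule F_lower[OF that])
    show "(\<lambda>i. norm (c i) * exp (- A * l i)) summable_on I"
    proof -
      have "(\<lambda>i. norm (exp (of_real (ln (real m)) * of_real A) / a m) *
        norm (case i of (k, xs) \<Rightarrow> of_nat k powr (- (of_real A - 1)) * prod_list (map (f (of_real A)) xs))) summable_on I"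
        unfolding I_def using has_sum_Times_mult(1)[OF zsm[of "of_real A"] geo(1)[of "of_real A"]] A
        by (intro summable_on_cmult_right) (simp add: case_prod_unfold)
      also have "?this \<longleftrightarrow> (\<lambda>i. norm (c i * exp (- of_real (l i) * of_real A))) summable_on I"
        by (intro summable_on_cong) (simp only: term_eq norm_mult)
      finally show ?thesis by (simp add: norm_mult mult.commute)
    qed
    show "((\<lambda>i. c i * exp (- of_real (l i) * s)) has_sum (riemann_zeta (s - 1) / F s)) I" if s: "Re s = A" for s
    proof -
      have "((\<lambda>i. exp (of_real (ln (real m)) * s) / a m *
        (case i of (k, xs) \<Rightarrow> of_nat k powr (- (s - 1)) * prod_list (map (f s) xs)))
        has_sum exp (of_real (ln (real m)) * s) / a m *
         (dzeta (s - 1) * infsum (\<lambda>xs. prod_list (map (f s) xs)) (lists {m<..}))) I"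
        unfolding I_def dzeta_def
        using has_sum_Times_mult(2)[OF zsm[of s] geo(1)[of s]] A s
        by (intro has_sum_cmult_right) auto
      also have "?this \<longleftrightarrow> ((\<lambda>i. c i * exp (- of_real (l i) * s)) has_sum exp (of_real (ln (real m)) * s) / a m *
         (dzeta (s - 1) * infsum (\<lambda>xs. prod_list (map (f s) xs)) (lists {m<..}))) I"
        by (intro has_sum_cong) (simp only: term_eq)
      also have "exp (of_real (ln (real m)) * s) / a m *
         (dzeta (s - 1) * infsum (\<lambda>xs. prod_list (map (f s) xs)) (lists {m<..}))
          = riemann_zeta (s - 1) / F s"
      proof -
        have s': "Re s \<ge> A" "Re s > 1" "Re (s - 1) > 1" using s A by auto
        show ?thesis
          unfolding infsumI[OF geo(2)[OF s'(1)]] F_eq[OF s'(2)] riemann_zeta_dzeta[OF s'(3)]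
            mult_minus_left exp_minus by (simp add: divide_inverse mult_ac)
      qed
      finally show ?thesis .
    qed
    \<comment> \<open>Each letter costs at least lam1 > 0, which bounds the length of the word. No
      summand other than - ln m is negative, so k and every single letter are bounded too.\<close>
    show "finite {i\<in>I. l i \<le> L}" for L
    proof (rule finite_subset)
      define L' where "L' = L + ln (real m)"
      define N where "N = nat \<lceil>exp L'\<rceil>"
      define R where "R = nat \<lceil>L' / lam1\<rceil>"
      define N2 where "N2 = nat \<lceil>exp (L' + ln (real m))\<rceil>"
      show "finite ({1..N} \<times> {xs. set xs \<subseteq> {..N2} \<and> length xs \<le> R})"
        by (intro finite_cartesian_product finite_lists_length_le) auto
      show "{i\<in>I. l i \<le> L} \<subseteq> {1..N} \<times> {xs. set xs \<subseteq> {..N2} \<and> length xs \<le> R}"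
      proof
        fix i assume "i \<in> {i\<in>I. l i \<le> L}"
        then obtain k xs where i: "(k, xs) \<in> I" and le: "l (k, xs) \<le> L" and i_eq: "i = (k, xs)"
          by (cases i) auto
        have k: "k \<ge> 1" and xs: "set xs \<subseteq> {m<..}" using i by (auto simp: I_def)
        have pos: "lam x \<ge> lam1" if "x \<in> set xs" for x using that xs lam_ge by auto
        have tot: "ln (real k) + sum_list (map lam xs) \<le> L'" using le by (simp add: l_def L'_def)
        have lnk: "ln (real k) \<ge> 0" using k by simp
        have len: "real (length xs) * lam1 \<le> sum_list (map lam xs)"
          using sum_list_mono[of xs "\<lambda>_. lam1" lam] pos by (simp add: sum_list_triv)
        moreover have "real (length xs) * lam1 \<ge> 0" using lam1 by simp
        ultimately have "ln (real k) \<le> L'" using tot by linarith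
        then have "exp (ln (real k)) \<le> exp L'" by (simp only: exp_le_cancel_iff)
        then have "real k \<le> exp L'" using k by simp
        then have kN: "k \<le> N" unfolding N_def by linarith
        have "real (length xs) * lam1 \<le> L'" using len tot lnk by linarith
        then have "real (length xs) \<le> L' / lam1" using lam1 by (simp add: field_simps)
        then have lR: "length xs \<le> R" unfolding R_def by linarith
        have "x \<le> N2" if x: "x \<in> set xs" for x
        proof -
          have "lam x \<le> sum_list (map lam xs)"
            using x pos lam1 by (intro member_le_sum_list) (auto intro: order_trans[of 0 lam1])
          then have "ln (real x) \<le> L' + ln (real m)" using tot lnk by (simp add: lam_def)
          moreover have "x > 0" using x xs by auto
          moreover have "exp (ln (real x)) \<le> exp (L' + ln (real m))"
            using calculation by (simp only: exp_le_cancel_iff)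
          ultimately have "real x \<le> exp (L' + ln (real m))" by simp
          then show ?thesis unfolding N2_def by linarith
        qed
        then show "i \<in> {1..N} \<times> {xs. set xs \<subseteq> {..N2} \<and> length xs \<le> R}"
          using k kN lR by (auto simp: i_eq)
      qed
    qed
  qed
qed

section \<open>Contour integrals\<close>

text \<open>The parameter z enters only through the exponential, so continuity of \<open>H\<close>
  is enough for differentiation under the integral.\<close>

lemma contour_integral_linepath_exp_holomorphic:
  assumes H: "continuous_on (closed_segment p q) H"
  shows "(\<lambda>z. contour_integral (linepath p q) (\<lambda>s. exp (s * z) * H s)) holomorphic_on UNIV"
proof -
  have lp: "continuous_on (UNIV \<times> {0..1}) (\<lambda>x::complex \<times> real. linepath p q (snd x))"
    unfolding linepath_def by (intro continuous_intros)
  have cH: "continuous_on (UNIV \<times> {0..1}) (\<lambda>x::complex \<times> real. H (linepath p q (snd x)))"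
    by (rule continuous_on_compose2[OF H lp]) (auto simp: linepath_in_path)
  have "(\<lambda>z. integral (cbox 0 1) (\<lambda>x::real. exp (linepath p q x * z) * H (linepath p q x) * (q - p)))
          holomorphic_on UNIV"
  proof (rule leibniz_rule_holomorphic)
    fix z :: complex and x :: real
    show "((\<lambda>z. exp (linepath p q x * z) * H (linepath p q x) * (q - p)) has_field_derivative
       linepath p q x * exp (linepath p q x * z) * H (linepath p q x) * (q - p)) (at z within UNIV)"
      by (auto intro!: derivative_eq_intros)
  next
    fix z :: complex
    have "(\<lambda>s. exp (s * z) * H s) contour_integrable_on linepath p q"
      by (intro contour_integrable_continuous_linepath continuous_intros H)
    then show "(\<lambda>x. exp (linepath p q x * z) * H (linepath p q x) * (q - p)) integrable_on cbox 0 1"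
      by (simp add: contour_integrable_on cbox_interval)
  next
    show "continuous_on (UNIV \<times> cbox 0 1) (\<lambda>(z, x). linepath p q x * exp (linepath p q x * z)
        * H (linepath p q x) * (q - p))"
      using lp cH unfolding case_prod_unfold cbox_interval by (intro continuous_intros)
  qed auto
  then show ?thesis
    by (simp add: contour_integral_integral cbox_interval)
qed

text \<open>The majorant M exp (Re s) is integrable towards the left, so the bound is independent of
  \<open>c\<close> and survives c -> -\<infinity>.\<close>

lemma contour_integral_horizontal_bound:
  assumes cont: "continuous_on (closed_segment (Complex c T) (Complex d T)) h" and "c \<le> d"
    and bound: "\<And>s. Im s = T \<Longrightarrow> c \<le> Re s \<Longrightarrow> Re s \<le> d \<Longrightarrow> norm (h s) \<le> M * exp (Re s)"
    and "M \<ge> 0"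
  shows "norm (contour_integral (linepath (Complex c T) (Complex d T)) h) \<le> M * exp d"
proof -
  let ?p = "Complex c T" and ?q = "Complex d T"
  have qp: "?q - ?p = of_real (d - c)" by (simp add: complex_eq_iff)
  have "((\<lambda>x. M * exp (c + x * (d - c)) * (d - c)) has_integral
      M * exp (c + 1 * (d - c)) - M * exp (c + 0 * (d - c))) {0..1}"
    by (rule fundamental_theorem_of_calculus)
       (auto intro!: derivative_eq_intros simp flip: has_real_derivative_iff_has_vector_derivative)
  then have I: "((\<lambda>x. M * exp (c + x * (d - c)) * (d - c)) has_integral (M * exp d - M * exp c)) {0..1}"
    by simp
  have "h contour_integrable_on linepath ?p ?q"
    by (rule contour_integrable_continuous_linepath[OF cont])
  then have int: "(\<lambda>x. h (linepath ?p ?q x) * (?q - ?p)) integrable_on {0..1}"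
    by (simp add: contour_integrable_on)
  have "norm (contour_integral (linepath ?p ?q) h) \<le> integral {0..1} (\<lambda>x. M * exp (c + x * (d - c)) * (d - c))"
    unfolding contour_integral_integral vector_derivative_linepath_at
  proof (rule integral_norm_bound_integral)
    fix x :: real assume x: "x \<in> {0..1}"
    have re: "Re (linepath ?p ?q x) = c + x * (d - c)" and im: "Im (linepath ?p ?q x) = T"
      by (simp_all add: linepath_def algebra_simps)
    have "c + x * (d - c) \<le> c + 1 * (d - c)"
      using x assms(2) by (intro add_left_mono mult_right_mono) auto
    then have "norm (h (linepath ?p ?q x)) \<le> M * exp (c + x * (d - c))"
      using bound[of "linepath ?p ?q x"] x assms(2) by (simp add: re im)
    then show "norm (h (linepath ?p ?q x) * (?q - ?p)) \<le> M * exp (c + x * (d - c)) * (d - c)"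
      unfolding norm_mult qp norm_of_real using assms(2,4) by (intro mult_mono) auto
  qed (use I int in auto)
  also have "\<dots> = M * exp d - M * exp c" using I by (rule integral_unique)
  also have "\<dots> \<le> M * exp d" using assms(4) by simp
  finally show ?thesis .
qed

text \<open>The truncated integrals are entire and uniformly Cauchy on unit balls, because
  \<open>H\<close> may be assumed to decay faster than exp (s z) grows there.\<close>

lemma horizontal_ray_entire:
  assumes cont: "continuous_on {s. Im s = T \<and> Re s \<le> a} H" and a: "a \<ge> 0"
    and decay: "\<And>E. \<exists>C. \<forall>s. Im s = T \<longrightarrow> Re s \<le> a \<longrightarrow> norm (H s) \<le> C * exp (E * Re s)"
  obtains J where "J holomorphic_on UNIV"
    "\<And>z. (\<lambda>N. contour_integral (linepath (Complex (- real N) T) (Complex a T)) (\<lambda>s. exp (s * z) * H s)) \<longlonglongrightarrow> J z"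
proof -
  define g where "g = (\<lambda>N z. contour_integral (linepath (Complex (- real N) T) (Complex a T)) (\<lambda>s. exp (s * z) * H s))"
  have cs: "continuous_on (closed_segment (Complex c T) (Complex d T)) H" if "d \<le> a" "c \<le> d" for c d
    by (rule continuous_on_subset[OF cont])
       (use that in \<open>auto simp: closed_segment_same_Im closed_segment_eq_real_ivl\<close>)
  have cs': "continuous_on (closed_segment (Complex c T) (Complex d T)) (\<lambda>s. exp (s * z) * H s)"
    if "d \<le> a" "c \<le> d" for c d z
    by (intro continuous_intros cs that)
  have hol: "g N holomorphic_on UNIV" for N
    unfolding g_def using a by (intro contour_integral_linepath_exp_holomorphic cs) auto
  have uc: "uniformly_convergent_on (cball z0 1) g" for z0
  proof -
    \<comment> \<open>For z in the unit ball around z0, exp (s z) grows to the left at most like exp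
      (|Re s| (|Re z0| + 1)); the extra unit in \<open>E\<close> leaves exp (Re s).\<close>
    define E where "E = \<bar>Re z0\<bar> + 2"
    obtain C where C: "\<And>s. Im s = T \<Longrightarrow> Re s \<le> a \<Longrightarrow> norm (H s) \<le> C * exp (E * Re s)"
      using decay[of E] by blast
    define K where "K = exp (\<bar>T\<bar> * (\<bar>Im z0\<bar> + 1)) * \<bar>C\<bar>"
    have K: "K \<ge> 0" by (simp add: K_def)
    have diff: "norm (g n z - g m z) \<le> K * exp (- real m)" if z: "z \<in> cball z0 1" and mn: "m \<le> n" for m n z
    proof -
      have re: "\<bar>Re z\<bar> \<le> \<bar>Re z0\<bar> + 1"
        using abs_Re_le_cmod[of "z0 - z"] z by (simp add: dist_norm)
      have im: "\<bar>Im z\<bar> \<le> \<bar>Im z0\<bar> + 1"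
        using abs_Im_le_cmod[of "z0 - z"] z by (simp add: dist_norm)
      \<comment> \<open>The relative position of -m on the segment from -n to a, which degenerates
        only for n = 0 and a = 0.\<close>
      define k where "k = (if real n + a = 0 then 0 else (real n - real m) / (real n + a))"
      have "g n z = contour_integral (linepath (Complex (- real n) T) (Complex (- real m) T)) (\<lambda>s. exp (s * z) * H s) + g m z"
        unfolding g_def
      proof (rule contour_integral_split)
        show "continuous_on (closed_segment (Complex (- real n) T) (Complex a T)) (\<lambda>s. exp (s * z) * H s)"
          using a by (intro cs') auto
        show "0 \<le> k" "k \<le> 1" using mn a by (auto simp: k_def divide_simps)
        show "Complex (- real m) T - Complex (- real n) T = k *\<^sub>R (Complex a T - Complex (- real n) T)"
          using mn a by (auto simp: complex_eq_iff k_def add.commute)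
      qed
      then have "norm (g n z - g m z) = norm (contour_integral (linepath (Complex (- real n) T) (Complex (- real m) T)) (\<lambda>s. exp (s * z) * H s))"
        by simp
      also have "\<dots> \<le> K * exp (- real m)"
      proof (rule contour_integral_horizontal_bound)
        show "continuous_on (closed_segment (Complex (- real n) T) (Complex (- real m) T)) (\<lambda>s. exp (s * z) * H s)"
          using a mn by (intro cs') auto
        fix s assume s: "Im s = T" "- real n \<le> Re s" "Re s \<le> - real m"
        have s0: "Re s \<le> 0" using s by simp
        have "Re (s * z) = Re s * Re z - T * Im z" using s by simp
        moreover have "Re s * Re z \<le> - Re s * (\<bar>Re z0\<bar> + 1)"
        proof -
          have "Re s * Re z \<le> \<bar>Re s\<bar> * \<bar>Re z\<bar>" by (simp flip: abs_mult)
          also have "\<dots> \<le> \<bar>Re s\<bar> * (\<bar>Re z0\<bar> + 1)" by (intro mult_left_mono re) auto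
          finally show ?thesis using s0 by simp
        qed
        moreover have "- T * Im z \<le> \<bar>T\<bar> * (\<bar>Im z0\<bar> + 1)"
        proof -
          have "- T * Im z \<le> \<bar>T\<bar> * \<bar>Im z\<bar>" by (metis abs_ge_self abs_minus_cancel abs_mult)
          also have "\<dots> \<le> \<bar>T\<bar> * (\<bar>Im z0\<bar> + 1)" by (intro mult_left_mono im) auto
          finally show ?thesis .
        qed
        ultimately have "Re (s * z) \<le> \<bar>T\<bar> * (\<bar>Im z0\<bar> + 1) + - Re s * (\<bar>Re z0\<bar> + 1)" by linarith
        then have "norm (exp (s * z)) \<le> exp (\<bar>T\<bar> * (\<bar>Im z0\<bar> + 1)) * exp (- Re s * (\<bar>Re z0\<bar> + 1))"
          by (simp flip: exp_add)
        moreover have "norm (H s) \<le> \<bar>C\<bar> * exp (E * Re s)"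
          using C[of s] s a by (intro order_trans[OF C mult_right_mono]) auto
        ultimately have "norm (exp (s * z)) * norm (H s) \<le>
          (exp (\<bar>T\<bar> * (\<bar>Im z0\<bar> + 1)) * exp (- Re s * (\<bar>Re z0\<bar> + 1))) * (\<bar>C\<bar> * exp (E * Re s))"
          by (intro mult_mono) auto
        also have "\<dots> = K * (exp (- Re s * (\<bar>Re z0\<bar> + 1)) * exp (E * Re s))" by (simp add: K_def)
        also have "exp (- Re s * (\<bar>Re z0\<bar> + 1)) * exp (E * Re s) = exp (Re s)"
          by (simp add: E_def algebra_simps flip: exp_add)
        finally show "norm (exp (s * z) * H s) \<le> K * exp (Re s)" by (simp add: norm_mult)
      qed (use K mn in auto)
      finally show ?thesis .
    qed
    show ?thesis
    proof (rule Cauchy_uniformly_convergent, rule uniformly_Cauchy_onI')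
      fix e :: real assume e: "e > 0"
      have "(\<lambda>m. K * exp (- real m)) \<longlonglongrightarrow> K * 0"
        by (intro tendsto_mult tendsto_const filterlim_compose[OF exp_at_bot]
             filterlim_compose[OF filterlim_uminus_at_bot_at_top] filterlim_real_sequentially)
      then have "\<forall>\<^sub>F m in sequentially. K * exp (- real m) < e"
        using e by (intro order_tendstoD(2)[of _ "K * 0"]) auto
      then obtain M where M: "\<And>m. m \<ge> M \<Longrightarrow> K * exp (- real m) < e"
        by (auto simp: eventually_sequentially)
      show "\<exists>M. \<forall>x\<in>cball z0 1. \<forall>m\<ge>M. \<forall>n>m. dist (g m x) (g n x) < e"
      proof (intro exI[of _ M] ballI allI impI)
        fix x m n assume "x \<in> cball z0 1" "M \<le> m" "m < n"
        then show "dist (g m x) (g n x) < e"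
          using diff[of x m n] M[of m] by (simp add: dist_norm norm_minus_commute)
      qed
    qed
  qed
  define J where "J = (\<lambda>z. lim (\<lambda>n. g n z))"
  have ul: "uniform_limit (cball z0 1) g J sequentially" for z0
    using uc[of z0] unfolding J_def by (simp add: uniformly_convergent_uniform_limit_iff)
  have "J holomorphic_on UNIV"
    by (rule holomorphic_uniform_sequence[of UNIV g]) (use hol ul in \<open>auto intro!: exI[of _ 1]\<close>)
  moreover have "(\<lambda>n. g n z) \<longlonglongrightarrow> J z" for z
    by (rule tendsto_uniform_limitI[OF ul[of z]]) auto
  ultimately show ?thesis using that[of J] by (simp add: g_def)
qed

section \<open>The right side: general Dirichlet series integrated term by term\<close>

text \<open>As a function of \<open>w\<close> this is a primitive of \<open>c i * exp (w * (z - l i))\<close>.\<close>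

definition gd_term :: "('i \<Rightarrow> complex) \<Rightarrow> ('i \<Rightarrow> real) \<Rightarrow> complex \<Rightarrow> complex \<Rightarrow> 'i \<Rightarrow> complex" where
  "gd_term c l w z i = c i * exp (w * (z - of_real (l i))) / (z - of_real (l i))"

lemma norm_gd_term:
  "norm (gd_term c l w z i) =
     norm (c i) * exp (- Re w * l i) * exp (Re (w * z)) / norm (z - of_real (l i))"
  unfolding gd_term_def norm_mult norm_divide norm_exp_eq_Re
  by (simp add: algebra_simps exp_diff exp_minus exp_add divide_inverse)

text \<open>Near z0 only the finitely many terms with l i \<le> Re z0 + 2 can have poles. For the
  others |z - l i| \<ge> 1 on the closed unit ball, and the summable majorant gives a holomorphic
  sum.\<close>

lemma gd_meromorphic:
  assumes W: "(\<lambda>i. norm (c i) * exp (- Re w * l i)) summable_on I"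
    and fin: "\<And>L. finite {i\<in>I. l i \<le> L}"
  shows "(\<lambda>z. \<Sum>\<^sub>\<infinity>i\<in>I. gd_term c l w z i) meromorphic_on UNIV"
proof (subst meromorphic_on_meromorphic_at, intro ballI)
  fix z0 :: complex
  define I0 where "I0 = {i\<in>I. l i \<le> Re z0 + 2}"
  define B where "B = exp (norm w * (norm z0 + 1))"
  have I0: "finite I0" using fin by (simp add: I0_def)
  have bound: "norm (gd_term c l w z i) \<le> norm (c i) * exp (- Re w * l i) * B"
    if "i \<in> I - I0" "z \<in> cball z0 1" for i z
  proof -
    have li: "l i > Re z0 + 2" using that by (auto simp: I0_def)
    have "\<bar>Re z0 - Re z\<bar> \<le> 1" using abs_Re_le_cmod[of "z0 - z"] that by (simp add: dist_norm)
    then have "1 \<le> \<bar>Re (z - of_real (l i))\<bar>" using li by simp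
    also have "\<dots> \<le> norm (z - of_real (l i))" by (rule abs_Re_le_cmod)
    finally have d: "1 \<le> norm (z - of_real (l i))" .
    have "norm z \<le> norm z0 + 1" using norm_triangle_ineq2[of z z0] that by (simp add: dist_norm norm_minus_commute)
    then have "Re (w * z) \<le> norm w * (norm z0 + 1)"
      by (intro order_trans[OF complex_Re_le_cmod]) (auto simp: norm_mult intro: mult_left_mono)
    then have "exp (Re (w * z)) \<le> B" by (simp add: B_def)
    then have "norm (c i) * exp (- Re w * l i) * exp (Re (w * z)) / norm (z - of_real (l i))
      \<le> norm (c i) * exp (- Re w * l i) * B / 1"
      using d by (intro frac_le mult_left_mono) (auto simp: B_def)
    then show ?thesis by (simp add: norm_gd_term)
  qed
  have sB: "(\<lambda>i. norm (c i) * exp (- Re w * l i) * B) summable_on I - I0"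
    by (rule summable_on_subset_banach[OF summable_on_cmult_left[OF W]]) auto
  have ul: "uniform_limit (cball z0 1) (\<lambda>X z. \<Sum>i\<in>X. gd_term c l w z i)
      (\<lambda>z. \<Sum>\<^sub>\<infinity>i\<in>I - I0. gd_term c l w z i) (finite_subsets_at_top (I - I0))"
    by (rule Weierstrass_m_test_general[OF bound sB])
  have ne: "z \<noteq> of_real (l i)" if "i \<in> I - I0" "z \<in> cball z0 1" for i z
  proof
    assume "z = of_real (l i)"
    then show False
      using abs_Re_le_cmod[of "z0 - z"] that by (auto simp: I0_def dist_norm)
  qed
  have ev: "\<forall>\<^sub>F X in finite_subsets_at_top (I - I0). continuous_on (cball z0 1) (\<lambda>z. \<Sum>i\<in>X. gd_term c l w z i)
        \<and> (\<lambda>z. \<Sum>i\<in>X. gd_term c l w z i) holomorphic_on ball z0 1"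
  proof (rule eventually_finite_subsets_at_top_weakI)
    fix X assume X: "X \<subseteq> I - I0"
    have "(\<lambda>z. \<Sum>i\<in>X. gd_term c l w z i) holomorphic_on cball z0 1"
      unfolding gd_term_def using ne X by (intro holomorphic_intros) auto
    then show "continuous_on (cball z0 1) (\<lambda>z. \<Sum>i\<in>X. gd_term c l w z i)
        \<and> (\<lambda>z. \<Sum>i\<in>X. gd_term c l w z i) holomorphic_on ball z0 1"
      using holomorphic_on_imp_continuous_on holomorphic_on_subset ball_subset_cball by blast
  qed
  have "(\<lambda>z. \<Sum>\<^sub>\<infinity>i\<in>I - I0. gd_term c l w z i) holomorphic_on ball z0 1"
    by (rule holomorphic_uniform_limit[OF ev ul]) auto
  then have "(\<lambda>z. \<Sum>\<^sub>\<infinity>i\<in>I - I0. gd_term c l w z i) analytic_on {z0}"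
    by (auto simp: analytic_at intro!: exI[of _ "ball z0 1"])
  then have mer: "(\<lambda>z. (\<Sum>i\<in>I0. gd_term c l w z i) + (\<Sum>\<^sub>\<infinity>i\<in>I - I0. gd_term c l w z i)) meromorphic_on {z0}"
    unfolding gd_term_def
    by (intro meromorphic_intros analytic_on_imp_meromorphic_on) (auto intro!: analytic_intros)
  have eq: "(\<Sum>\<^sub>\<infinity>i\<in>I. gd_term c l w z i) = (\<Sum>i\<in>I0. gd_term c l w z i) + (\<Sum>\<^sub>\<infinity>i\<in>I - I0. gd_term c l w z i)"
    if "z \<in> cball z0 1" for z
  proof -
    have "(\<lambda>i. norm (gd_term c l w z i)) summable_on I - I0"
      by (rule summable_on_comparison_test[OF sB]) (use bound that in auto)
    then have "(\<lambda>i. gd_term c l w z i) summable_on I - I0" by (rule abs_summable_summable)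
    then have "infsum (gd_term c l w z) (I0 \<union> (I - I0)) = infsum (gd_term c l w z) I0 + infsum (gd_term c l w z) (I - I0)"
      using I0 by (intro infsum_Un_disjoint) auto
    moreover have "I0 \<union> (I - I0) = I" by (auto simp: I0_def)
    ultimately show ?thesis using I0 by simp
  qed
  have "\<forall>\<^sub>F z in at z0. z \<in> ball z0 1"
    by (intro eventually_at_in_open') auto
  then have "\<forall>\<^sub>F z in at z0. (\<Sum>\<^sub>\<infinity>i\<in>I. gd_term c l w z i) =
      (\<Sum>i\<in>I0. gd_term c l w z i) + (\<Sum>\<^sub>\<infinity>i\<in>I - I0. gd_term c l w z i)"
    by eventually_elim (use eq in auto)
  then show "(\<lambda>z. \<Sum>\<^sub>\<infinity>i\<in>I. gd_term c l w z i) meromorphic_on {z0}"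
    using mer by (subst meromorphic_on_cong) auto
qed

text \<open>The \<open>l i\<close> are real, so every denominator is at least Im z. For fixed Re w
  the bound decays as Im w grows, which removes the upper end of the right side.\<close>

lemma gd_bound:
  assumes W: "(\<lambda>i. norm (c i) * exp (- Re w * l i)) summable_on I" and z: "Im z > 0"
  shows "gd_term c l w z summable_on I"
    and "norm (\<Sum>\<^sub>\<infinity>i\<in>I. gd_term c l w z i) \<le>
      (\<Sum>\<^sub>\<infinity>i\<in>I. norm (c i) * exp (- Re w * l i)) * (exp (Re (w * z)) / Im z)"
proof -
  have bound: "norm (gd_term c l w z i) \<le> norm (c i) * exp (- Re w * l i) * (exp (Re (w * z)) / Im z)" for i
  proof -
    have "Im z \<le> norm (z - of_real (l i))"
      using abs_Im_le_cmod[of "z - of_real (l i)"] by simp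
    then have "norm (c i) * exp (- Re w * l i) * exp (Re (w * z)) / norm (z - of_real (l i))
      \<le> norm (c i) * exp (- Re w * l i) * exp (Re (w * z)) / Im z"
      using z by (intro divide_left_mono mult_pos_pos) auto
    then show ?thesis by (simp add: norm_gd_term)
  qed
  have s1: "(\<lambda>i. norm (c i) * exp (- Re w * l i) * (exp (Re (w * z)) / Im z)) summable_on I"
    by (rule summable_on_cmult_left[OF W])
  have s2: "(\<lambda>i. norm (gd_term c l w z i)) summable_on I"
    by (rule summable_on_comparison_test[OF s1]) (use bound in auto)
  then show "gd_term c l w z summable_on I" by (rule abs_summable_summable)
  have "norm (\<Sum>\<^sub>\<infinity>i\<in>I. gd_term c l w z i) \<le> (\<Sum>\<^sub>\<infinity>i\<in>I. norm (gd_term c l w z i))"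
    by (rule norm_infsum_bound[OF s2])
  also have "\<dots> \<le> (\<Sum>\<^sub>\<infinity>i\<in>I. norm (c i) * exp (- Re w * l i) * (exp (Re (w * z)) / Im z))"
    by (rule infsum_mono[OF s2 s1 bound])
  also have "\<dots> = (\<Sum>\<^sub>\<infinity>i\<in>I. norm (c i) * exp (- Re w * l i)) * (exp (Re (w * z)) / Im z)"
    by (rule infsum_cmult_left')
  finally show "norm (\<Sum>\<^sub>\<infinity>i\<in>I. gd_term c l w z i) \<le>
      (\<Sum>\<^sub>\<infinity>i\<in>I. norm (c i) * exp (- Re w * l i)) * (exp (Re (w * z)) / Im z)" .
qed

text \<open>The expansion converges uniformly on the bounded segment, so it may be integrated
  through the primitives \<open>gd_term\<close>; for Im z > 0 the two endpoint series can be summed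
  separately.\<close>

lemma gd_vertical_integral:
  assumes W: "(\<lambda>i. norm (c i) * exp (- A * l i)) summable_on I" and z: "Im z > 0"
    and h: "\<And>s. Re s = A \<Longrightarrow> ((\<lambda>i. c i * exp (- of_real (l i) * s)) has_sum h s) I"
  shows "contour_integral (linepath (Complex A T0) (Complex A T)) (\<lambda>s. exp (s * z) * h s)
     = (\<Sum>\<^sub>\<infinity>i\<in>I. gd_term c l (Complex A T) z i) - (\<Sum>\<^sub>\<infinity>i\<in>I. gd_term c l (Complex A T0) z i)"
proof -
  let ?\<gamma> = "linepath (Complex A T0) (Complex A T)"
  let ?f = "\<lambda>i s. exp (s * z) * (c i * exp (- of_real (l i) * s))"
  have prim: "(?f i has_contour_integral (gd_term c l (Complex A T) z i - gd_term c l (Complex A T0) z i)) ?\<gamma>" for i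
  proof -
    have nz: "z - of_real (l i) \<noteq> 0" using z by (auto simp: complex_eq_iff)
    have der: "((\<lambda>s. gd_term c l s z i) has_field_derivative ?f i s) (at s within UNIV)" for s
    proof -
      have "((\<lambda>s. gd_term c l s z i) has_field_derivative
          c i * (exp (s * (z - of_real (l i))) * (z - of_real (l i))) / (z - of_real (l i))) (at s within UNIV)"
        unfolding gd_term_def by (auto intro!: derivative_eq_intros)
      also have "c i * (exp (s * (z - of_real (l i))) * (z - of_real (l i))) / (z - of_real (l i)) = ?f i s"
      proof -
        have "exp (s * (z - of_real (l i))) = exp (s * z) * exp (- of_real (l i) * s)"
          by (simp add: algebra_simps flip: exp_add)
        then show ?thesis using nz by simp
      qed
      finally show ?thesis .
    qed
    have "((?f i) has_contour_integral (gd_term c l (pathfinish ?\<gamma>) z i - gd_term c l (pathstart ?\<gamma>) z i)) ?\<gamma>"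
      by (rule contour_integral_primitive[OF der]) auto
    then show ?thesis by simp
  qed
  define B where "B = exp (norm z * (\<bar>A\<bar> + \<bar>T0\<bar> + \<bar>T\<bar>))"
  have ul: "uniform_limit (path_image ?\<gamma>) (\<lambda>X s. \<Sum>i\<in>X. ?f i s) (\<lambda>s. exp (s * z) * h s) (finite_subsets_at_top I)"
  proof (rule Weierstrass_m_test_general')
    show "(\<lambda>i. norm (c i) * exp (- A * l i) * B) summable_on I"
      by (rule summable_on_cmult_left[OF W])
    fix s assume "s \<in> path_image ?\<gamma>"
    then have s: "Re s = A" "Im s \<in> closed_segment T0 T"
      by (auto simp: closed_segment_same_Re)
    show "((\<lambda>i. ?f i s) has_sum exp (s * z) * h s) I"
      by (intro has_sum_cmult_right h s)
    fix i
    have "\<bar>Im s\<bar> \<le> \<bar>T0\<bar> + \<bar>T\<bar>" using s(2) by (auto simp: closed_segment_eq_real_ivl split: if_splits)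
    then have "norm s \<le> \<bar>A\<bar> + \<bar>T0\<bar> + \<bar>T\<bar>" using cmod_le[of s] s by simp
    then have "Re (s * z) \<le> norm z * (\<bar>A\<bar> + \<bar>T0\<bar> + \<bar>T\<bar>)"
      by (intro order_trans[OF complex_Re_le_cmod]) (auto simp: norm_mult mult.commute[of "norm z"] intro!: mult_right_mono)
    then have "norm (exp (s * z)) \<le> B" by (simp add: B_def)
    then have "norm (exp (s * z)) * (norm (c i) * exp (- A * l i)) \<le> B * (norm (c i) * exp (- A * l i))"
      by (intro mult_right_mono) auto
    then show "norm (?f i s) \<le> norm (c i) * exp (- A * l i) * B"
      using s by (simp add: norm_mult mult_ac)
  qed
  have lim: "((\<lambda>X. contour_integral ?\<gamma> (\<lambda>s. \<Sum>i\<in>X. ?f i s)) \<longlongrightarrow> contour_integral ?\<gamma> (\<lambda>s. exp (s * z) * h s))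
      (finite_subsets_at_top I)"
  proof (rule contour_integral_uniform_limit(2)[OF _ ul])
    show "\<forall>\<^sub>F X in finite_subsets_at_top I. (\<lambda>s. \<Sum>i\<in>X. ?f i s) contour_integrable_on ?\<gamma>"
      by (rule eventually_finite_subsets_at_top_weakI)
         (intro contour_integrable_continuous_linepath continuous_intros)
    show "norm (vector_derivative ?\<gamma> (at t)) \<le> norm (Complex A T - Complex A T0)" for t
      by simp
  qed auto
  have eq: "contour_integral ?\<gamma> (\<lambda>s. \<Sum>i\<in>X. ?f i s) = (\<Sum>i\<in>X. gd_term c l (Complex A T) z i - gd_term c l (Complex A T0) z i)"
    if "finite X" for X
    by (intro contour_integral_unique has_contour_integral_sum prim that)
  have ev: "\<forall>\<^sub>F X in finite_subsets_at_top I. contour_integral ?\<gamma> (\<lambda>s. \<Sum>i\<in>X. ?f i s)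
      = (\<Sum>i\<in>X. gd_term c l (Complex A T) z i - gd_term c l (Complex A T0) z i)"
    by (rule eventually_finite_subsets_at_top_weakI) (rule eq)
  have hs: "((\<lambda>i. gd_term c l (Complex A T) z i - gd_term c l (Complex A T0) z i) has_sum
     contour_integral ?\<gamma> (\<lambda>s. exp (s * z) * h s)) I"
    unfolding has_sum_def using Lim_transform_eventually[OF lim ev] .
  have g: "gd_term c l (Complex A T) z summable_on I" for T
    using W z by (intro gd_bound) auto
  have "((\<lambda>i. gd_term c l (Complex A T) z i + - gd_term c l (Complex A T0) z i) has_sum
     (\<Sum>\<^sub>\<infinity>i\<in>I. gd_term c l (Complex A T) z i) + - (\<Sum>\<^sub>\<infinity>i\<in>I. gd_term c l (Complex A T0) z i)) I"
    by (intro has_sum_add has_sum_infsum g) (simp add: has_sum_uminus has_sum_infsum[OF g])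
  then show ?thesis using has_sum_unique[OF hs] by simp
qed

section \<open>Residues in a rectangle\<close>

lemma residue_simple_zero:
  assumes h: "h holomorphic_on U" and F: "F holomorphic_on U" and U: "open U" "connected U" "\<rho> \<in> U"
    and zero: "F \<rho> = 0" and ord: "zorder F \<rho> = 1" and nz: "\<exists>w\<in>U. F w \<noteq> 0"
  shows "residue (\<lambda>w. h w / F w) \<rho> = h \<rho> / deriv F \<rho>"
proof -
  define g where "g = zor_poly F \<rho>"
  obtain r where r: "r > 0" "cball \<rho> r \<subseteq> U" "g holomorphic_on cball \<rho> r"
    "\<And>w. w \<in> cball \<rho> r \<Longrightarrow> F w = g w * (w - \<rho>)" "\<And>w. w \<in> cball \<rho> r \<Longrightarrow> g w \<noteq> 0"
    using zorder_exist_zero[OF F U nz] ord zero by (auto simp: g_def)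
  have gb: "g holomorphic_on ball \<rho> r" "h holomorphic_on ball \<rho> r"
    using r h holomorphic_on_subset ball_subset_cball by blast+
  have "(g has_field_derivative deriv g \<rho>) (at \<rho>)"
    using gb(1) r(1) by (intro holomorphic_derivI[of _ "ball \<rho> r"]) auto
  then have "((\<lambda>w. g w * (w - \<rho>)) has_field_derivative g \<rho>) (at \<rho>)"
    by (auto intro!: derivative_eq_intros)
  then have "(F has_field_derivative g \<rho>) (at \<rho>)"
  proof (rule has_field_derivative_transform_within_open)
    show "open (ball \<rho> r)" "\<rho> \<in> ball \<rho> r" using r(1) by auto
    show "g w * (w - \<rho>) = F w" if "w \<in> ball \<rho> r" for w
      using r(4)[of w] that by auto
  qed
  then have der: "deriv F \<rho> = g \<rho>" by (rule DERIV_imp_deriv)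
  have "residue (\<lambda>w. h w / F w) \<rho> = residue (\<lambda>w. h w / g w / (w - \<rho>)) \<rho>"
  proof (rule residue_cong)
    have "\<forall>\<^sub>F w in at \<rho>. w \<in> ball \<rho> r"
      using r(1) by (intro eventually_at_in_open') auto
    then show "\<forall>\<^sub>F w in at \<rho>. h w / F w = h w / g w / (w - \<rho>)"
      by eventually_elim (use r(4) in auto)
  qed auto
  also have "\<dots> = h \<rho> / g \<rho>"
    using r gb by (intro residue_simple[of "ball \<rho> r"] holomorphic_intros) auto
  finally show ?thesis by (simp add: der)
qed

text \<open>All sides are oriented to the right or upwards, to match the integrals estimated
  separately; this reverses the top and left sides.\<close>

lemma contour_integral_rectpath:
  assumes "continuous_on (path_image (rectpath (Complex b T0) (Complex a T))) f"
  shows "contour_integral (rectpath (Complex b T0) (Complex a T)) f =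
     contour_integral (linepath (Complex b T0) (Complex a T0)) f
     + contour_integral (linepath (Complex a T0) (Complex a T)) f
     - contour_integral (linepath (Complex b T) (Complex a T)) f
     - contour_integral (linepath (Complex b T0) (Complex b T)) f"
proof -
  have pi: "path_image (rectpath (Complex b T0) (Complex a T)) =
     closed_segment (Complex b T0) (Complex a T0) \<union> closed_segment (Complex a T0) (Complex a T) \<union>
     closed_segment (Complex a T) (Complex b T) \<union> closed_segment (Complex b T) (Complex b T0)"
    by (simp add: rectpath_def Let_def path_image_join Un_assoc)
  have int: "f contour_integrable_on linepath (Complex b T0) (Complex a T0)"
    "f contour_integrable_on linepath (Complex a T0) (Complex a T)"
    "f contour_integrable_on linepath (Complex a T) (Complex b T)"
    "f contour_integrable_on linepath (Complex b T) (Complex b T0)"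
    by (intro contour_integrable_continuous_linepath continuous_on_subset[OF assms]; force simp: pi)+
  have rev: "contour_integral (linepath q p) f = - contour_integral (linepath p q) f" for p q
    using contour_integral_reversepath[of "linepath p q" f] by simp
  have "contour_integral (rectpath (Complex b T0) (Complex a T)) f =
     contour_integral (linepath (Complex b T0) (Complex a T0)) f
     + (contour_integral (linepath (Complex a T0) (Complex a T)) f
     + (contour_integral (linepath (Complex a T) (Complex b T)) f
     + contour_integral (linepath (Complex b T) (Complex b T0)) f))"
    unfolding rectpath_def Let_def complex.sel using int by (simp add: contour_integrable_joinI)
  then show ?thesis
    unfolding rev[of "Complex b T" "Complex a T"] rev[of "Complex b T0" "Complex b T"] by simp
qed

lemma rectangle_residues:
  assumes h: "h holomorphic_on {s. Im s > 0}" and F: "F holomorphic_on {s. Im s > 0}"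
    and strip: "\<And>\<rho>. Im \<rho> > 0 \<Longrightarrow> F \<rho> = 0 \<Longrightarrow> b < Re \<rho> \<and> Re \<rho> < a"
    and simple: "\<And>\<rho>. Im \<rho> > 0 \<Longrightarrow> F \<rho> = 0 \<Longrightarrow> zorder F \<rho> = 1"
    and fin: "\<And>T. finite {\<rho>. F \<rho> = 0 \<and> 0 < Im \<rho> \<and> Im \<rho> < T}"
    and T: "0 < T0" "T0 < T" and lines: "\<And>s. Im s = T0 \<or> Im s = T \<Longrightarrow> F s \<noteq> 0" and ba: "b < a"
  shows "contour_integral (rectpath (Complex b T0) (Complex a T)) (\<lambda>s. h s / F s) =
    2 * pi * \<i> * (\<Sum>\<rho> | F \<rho> = 0 \<and> T0 < Im \<rho> \<and> Im \<rho> < T. h \<rho> / deriv F \<rho>)"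
proof -
  let ?p = "Complex b T0" and ?q = "Complex a T"
  \<comment> \<open>The margin of 1 keeps the closed rectangle inside the open strip
    \<open>S\<close>. The listed zeros outside the rectangle have winding number 0.\<close>
  define pts where "pts = {\<rho>. F \<rho> = 0 \<and> 0 < Im \<rho> \<and> Im \<rho> < T + 1}"
  define S where "S = {s. 0 < Im s} \<inter> {s. Im s < T + 1}"
  have S: "open S" "convex S"
    unfolding S_def by (auto intro!: open_Int convex_Int convex_halfspace_Im_gt convex_halfspace_Im_lt
        open_halfspace_Im_gt open_halfspace_Im_lt)
  have box: "cbox ?p ?q \<subseteq> S" using T by (auto simp: S_def in_cbox_complex_iff)
  have pi: "path_image (rectpath ?p ?q) \<subseteq> cbox ?p ?q - box ?p ?q"
    using path_image_rectpath_cbox_minus_box[of ?p ?q] T ba by auto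
  have "contour_integral (rectpath ?p ?q) (\<lambda>s. h s / F s)
     = 2 * pi * \<i> * (\<Sum>\<rho>\<in>pts. winding_number (rectpath ?p ?q) \<rho> * residue (\<lambda>s. h s / F s) \<rho>)"
  proof (rule Residue_theorem[of S])
    show "connected S" using S by (simp add: convex_connected)
    show "finite pts" unfolding pts_def by (rule fin)
    show "(\<lambda>s. h s / F s) holomorphic_on S - pts"
      by (intro holomorphic_intros holomorphic_on_subset[OF h] holomorphic_on_subset[OF F])
         (auto simp: S_def pts_def)
    have "\<rho> \<notin> path_image (rectpath ?p ?q)" if "\<rho> \<in> pts" for \<rho>
      using that strip[of \<rho>] lines[of \<rho>] path_image_rectpath[of ?p ?q] T ba by (auto simp: pts_def)
    then show "path_image (rectpath ?p ?q) \<subseteq> S - pts" using pi box by auto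
    show "\<forall>z. z \<notin> S \<longrightarrow> winding_number (rectpath ?p ?q) z = 0"
      using box T ba by (auto intro!: winding_number_rectpath_outside)
  qed (use S in auto)
  also have "(\<Sum>\<rho>\<in>pts. winding_number (rectpath ?p ?q) \<rho> * residue (\<lambda>s. h s / F s) \<rho>)
     = (\<Sum>\<rho> | F \<rho> = 0 \<and> T0 < Im \<rho> \<and> Im \<rho> < T. h \<rho> / deriv F \<rho>)"
  proof (rule sum.mono_neutral_cong_right)
    show "finite pts" unfolding pts_def by (rule fin)
    show "{\<rho>. F \<rho> = 0 \<and> T0 < Im \<rho> \<and> Im \<rho> < T} \<subseteq> pts" using T by (auto simp: pts_def)
    show "\<forall>\<rho>\<in>pts - {\<rho>. F \<rho> = 0 \<and> T0 < Im \<rho> \<and> Im \<rho> < T}.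
        winding_number (rectpath ?p ?q) \<rho> * residue (\<lambda>s. h s / F s) \<rho> = 0"
    proof
      fix \<rho> assume r: "\<rho> \<in> pts - {\<rho>. F \<rho> = 0 \<and> T0 < Im \<rho> \<and> Im \<rho> < T}"
      then have "\<rho> \<notin> cbox ?p ?q"
        using lines[of \<rho>] by (auto simp: pts_def in_cbox_complex_iff)
      then have "winding_number (rectpath ?p ?q) \<rho> = 0"
        using T ba by (intro winding_number_rectpath_outside) auto
      then show "winding_number (rectpath ?p ?q) \<rho> * residue (\<lambda>s. h s / F s) \<rho> = 0" by simp
    qed
    fix \<rho> assume r: "\<rho> \<in> {\<rho>. F \<rho> = 0 \<and> T0 < Im \<rho> \<and> Im \<rho> < T}"
    then have im: "Im \<rho> > 0" "F \<rho> = 0" using T by auto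
    have "\<rho> \<in> box ?p ?q" using r strip[OF im] by (auto simp: in_box_complex_iff)
    then have "winding_number (rectpath ?p ?q) \<rho> = 1" by (rule winding_number_rectpath)
    moreover have "residue (\<lambda>s. h s / F s) \<rho> = h \<rho> / deriv F \<rho>"
    proof (rule residue_simple_zero[OF h F])
      show "open {s. Im s > 0}" "connected {s. Im s > 0}"
        by (auto intro: open_halfspace_Im_gt convex_connected convex_halfspace_Im_gt)
      show "\<exists>w\<in>{s. Im s > 0}. F w \<noteq> 0"
        using lines[of "Complex 0 T"] T by (intro bexI[of _ "Complex 0 T"]) auto
    qed (use im simple in auto)
    ultimately show "winding_number (rectpath ?p ?q) \<rho> * residue (\<lambda>s. h s / F s) \<rho> = h \<rho> / deriv F \<rho>"
      by simp
  qed
  finally show ?thesis .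
qed

section \<open>Zeros and bounds on admissible heights\<close>

lemma selberg_class_holomorphic:
  assumes "F \<in> selberg_class"
  shows "F holomorphic_on - {1}"
proof -
  obtain m :: nat and G where G: "G holomorphic_on UNIV" "\<And>s. s \<noteq> 1 \<Longrightarrow> G s = (s - 1) ^ m * F s"
    using assms by (auto simp: selberg_class_def entire_of_finite_order_def)
  have "(\<lambda>s. G s / (s - 1) ^ m) holomorphic_on - {1}"
    by (intro holomorphic_intros holomorphic_on_subset[OF G(1)]) auto
  then show ?thesis
    by (rule holomorphic_transform) (use G(2) in auto)
qed

text \<open>The Euler factors are exponentials, and a product in the sense of
  \<open>has_prod\<close> vanishes only if one of its factors does.\<close>

lemma selberg_class_nonzero:
  assumes "F \<in> selberg_class" "Re s > 1"
  shows "F s \<noteq> 0"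
proof -
  obtain b :: "nat \<Rightarrow> complex" where
    "(\<lambda>p. if prime p then exp (\<Sum>l. b (p ^ l) * of_nat p powr (- (of_nat l * s))) else 1) has_prod F s"
    using assms by (auto simp: selberg_class_def)
  from has_prod_eq_0_iff[OF this] show ?thesis by (auto split: if_splits)
qed

text \<open>For Re \<rho> < 0 the reflected point has real part above 1, where neither
  \<open>F\<close> nor the Gamma factor vanishes, contradicting the functional equation.\<close>

lemma selberg_class_zeros_in_strip:
  assumes F: "F \<in> selberg_class"
    and FE: "selberg_functional_equation F Q \<omega> 1 (\<lambda>_. 1) (\<lambda>_. of_real \<mu>)"
    and \<rho>: "Im \<rho> > 0" "F \<rho> = 0"
  shows "0 \<le> Re \<rho> \<and> Re \<rho> \<le> 1"
proof -
  have "\<not> Re \<rho> > 1" using selberg_class_nonzero[OF F] \<rho> by auto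
  moreover have "\<not> Re \<rho> < 0"
  proof
    assume "Re \<rho> < 0"
    then have "F (1 - cnj \<rho>) \<noteq> 0" using selberg_class_nonzero[OF F, of "1 - cnj \<rho>"] by auto
    moreover have "Q > 0" using FE by (auto simp: selberg_functional_equation_def)
    moreover have "Gamma (1 - cnj \<rho> + of_real \<mu>) \<noteq> 0"
      using \<rho> by (auto simp: Gamma_eq_zero_iff intro!: notin_nonpos_Ints_of_Im)
    ultimately show False using norm_functional_equation[OF FE \<rho>(1)] \<rho>(2) by simp
  qed
  ultimately show ?thesis by auto
qed

text \<open>The strip confines these zeros to a compact rectangle, and there they are zeros of the
  nontrivial entire function (s - 1) ^ m F s.\<close>

lemma selberg_class_finite_zeros:
  assumes F: "F \<in> selberg_class"
    and strip: "\<And>\<rho>. Im \<rho> > 0 \<Longrightarrow> F \<rho> = 0 \<Longrightarrow> 0 \<le> Re \<rho> \<and> Re \<rho> \<le> 1"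
  shows "finite {\<rho>. F \<rho> = 0 \<and> 0 < Im \<rho> \<and> Im \<rho> < T}"
proof -
  obtain m :: nat and G where G: "G holomorphic_on UNIV" "\<And>s. s \<noteq> 1 \<Longrightarrow> G s = (s - 1) ^ m * F s"
    using F by (auto simp: selberg_class_def entire_of_finite_order_def)
  have G2: "G 2 \<noteq> 0" using G(2)[of 2] selberg_class_nonzero[OF F, of 2] by auto
  have "finite {s \<in> cbox 0 (Complex 1 T). G s = 0}"
  proof (cases "G constant_on UNIV")
    case True
    then have "G s \<noteq> 0" for s using G2 by (auto simp: constant_on_def)
    then show ?thesis by simp
  next
    case False
    then show ?thesis by (intro holomorphic_compact_finite_zeros[OF G(1)]) auto
  qed
  moreover have "{\<rho>. F \<rho> = 0 \<and> 0 < Im \<rho> \<and> Im \<rho> < T} \<subseteq> {s \<in> cbox 0 (Complex 1 T). G s = 0}"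
  proof
    fix \<rho> assume r: "\<rho> \<in> {\<rho>. F \<rho> = 0 \<and> 0 < Im \<rho> \<and> Im \<rho> < T}"
    then have "\<rho> \<noteq> 1" by auto
    then show "\<rho> \<in> {s \<in> cbox 0 (Complex 1 T). G s = 0}"
      using r strip[of \<rho>] G(2)[of \<rho>] by (auto simp: in_cbox_complex_iff)
  qed
  ultimately show ?thesis by (rule finite_subset[rotated])
qed

text \<open>Gamma poles are real for real \<mu>, so above the real axis the nontrivial zeros are
  simply the zeros.\<close>

lemma f_partial_eq:
  assumes hol: "F holomorphic_on - {1}"
  shows "f_partial F 1 (\<lambda>_. 1) (\<lambda>_. of_real \<mu>) T z =
    (\<Sum>\<rho> | F \<rho> = 0 \<and> 0 < Im \<rho> \<and> Im \<rho> < T. exp (\<rho> * z) * riemann_zeta (\<rho> - 1) / deriv F \<rho>)"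
proof -
  have g: "\<rho> \<notin> gamma_poles 1 (\<lambda>_. 1) (\<lambda>_. of_real \<mu>)" if "Im \<rho> > 0" for \<rho>
    using notin_nonpos_Ints_of_Im[of "\<rho> + of_real \<mu>"] that by (simp add: gamma_poles_def)
  have "F analytic_on {\<rho>}" if "Im \<rho> > 0" for \<rho>
    using hol that by (auto simp: analytic_at intro!: exI[of _ "- {1}"])
  then have "{\<rho>. \<rho> \<in> nontrivial_zeros F 1 (\<lambda>_. 1) (\<lambda>_. of_real \<mu>) \<union>
      {\<rho> \<in> trivial_zeros F 1 (\<lambda>_. 1) (\<lambda>_. of_real \<mu>). Re \<rho> = 0} \<and> 0 < Im \<rho> \<and> Im \<rho> < T}
    = {\<rho>. F \<rho> = 0 \<and> 0 < Im \<rho> \<and> Im \<rho> < T}"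
    using g by (auto simp: nontrivial_zeros_def trivial_zeros_def zeros_def)
  then show ?thesis unfolding f_partial_def by (rule sum.cong) simp
qed

text \<open>Admissibility speaks of windows around T. The choice T = n + 1/2 captures [n, n + 1]
  once D ln (ln T) \<ge> 1/2 and turns the bound into one in n.\<close>

lemma admissible_heightsD:
  assumes "admissible_heights F \<tau>"
  obtains n0 :: nat and K C :: real where "n0 \<ge> 2" "K \<ge> 0" "C > 0"
    "\<And>n. n \<ge> n0 \<Longrightarrow> real n \<le> \<tau> n \<and> \<tau> n \<le> real n + 1"
    "\<And>n s. n \<ge> n0 \<Longrightarrow> Im s = \<tau> n \<Longrightarrow> Re s \<ge> - 2 \<Longrightarrow>
       F s \<noteq> 0 \<and> 1 / norm (F s) \<le> K * exp (C * (ln (real n + 1))\<^sup>2)"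
proof -
  obtain D C K where D: "D > 0" and ev: "\<forall>\<^sub>F T in at_top. \<forall>n::nat.
        {real n..real n + 1} \<subseteq> {T - D * ln (ln T)..T + D * ln (ln T)} \<longrightarrow>
          \<tau> n \<in> {real n..real n + 1} \<and>
          (\<forall>\<sigma>\<ge>-2. F (Complex \<sigma> (\<tau> n)) \<noteq> 0 \<and>
                  1 / norm (F (Complex \<sigma> (\<tau> n))) \<le> K * exp (C * (ln T)\<^sup>2))"
    using assms unfolding admissible_heights_def by blast
  have lim: "filterlim (\<lambda>n. real n + 1/2) at_top sequentially" by real_asymp
  have "filterlim (\<lambda>n. D * ln (ln (real n + 1/2))) at_top sequentially"
    using D by real_asymp
  then have "\<forall>\<^sub>F n in sequentially. D * ln (ln (real n + 1/2)) \<ge> 1/2"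
    unfolding filterlim_at_top by blast
  with eventually_compose_filterlim[OF ev lim] eventually_ge_at_top[of 2]
  have "\<forall>\<^sub>F n in sequentially. n \<ge> 2 \<and> real n \<le> \<tau> n \<and> \<tau> n \<le> real n + 1 \<and>
    (\<forall>s. Im s = \<tau> n \<longrightarrow> Re s \<ge> - 2 \<longrightarrow> F s \<noteq> 0 \<and> 1 / norm (F s) \<le> \<bar>K\<bar> * exp ((\<bar>C\<bar> + 1) * (ln (real n + 1))\<^sup>2))"
  proof eventually_elim
    case (elim n)
    define T where "T = real n + 1/2"
    have "{real n..real n + 1} \<subseteq> {T - D * ln (ln T)..T + D * ln (ln T)}"
      using elim(3) unfolding T_def by auto
    then have *: "\<tau> n \<in> {real n..real n + 1}" "\<And>\<sigma>. \<sigma> \<ge> -2 \<Longrightarrow> F (Complex \<sigma> (\<tau> n)) \<noteq> 0 \<and>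
                  1 / norm (F (Complex \<sigma> (\<tau> n))) \<le> K * exp (C * (ln T)\<^sup>2)"
      using elim(1) unfolding T_def by blast+
    have "(ln T)\<^sup>2 \<le> (ln (real n + 1))\<^sup>2"
      using elim(2) unfolding T_def by (intro power_mono) auto
    \<comment> \<open>The given constants may have any sign; |C| + 1 and |K| make the bound monotone
      and the exponent positive.\<close>
    then have "C * (ln T)\<^sup>2 \<le> (\<bar>C\<bar> + 1) * (ln (real n + 1))\<^sup>2"
      by (intro mult_mono) auto
    then have le: "K * exp (C * (ln T)\<^sup>2) \<le> \<bar>K\<bar> * exp ((\<bar>C\<bar> + 1) * (ln (real n + 1))\<^sup>2)"
      by (intro mult_mono) auto
    have "F s \<noteq> 0 \<and> 1 / norm (F s) \<le> \<bar>K\<bar> * exp ((\<bar>C\<bar> + 1) * (ln (real n + 1))\<^sup>2)"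
      if "Im s = \<tau> n" "Re s \<ge> - 2" for s
    proof -
      have "Complex (Re s) (\<tau> n) = s" using that by (simp add: complex_eq_iff)
      then show ?thesis using *(2)[OF that(2)] le by auto
    qed
    then show ?case using elim(2) *(1) by auto
  qed
  then obtain N where N: "\<And>n. n \<ge> N \<Longrightarrow> n \<ge> 2 \<and> real n \<le> \<tau> n \<and> \<tau> n \<le> real n + 1 \<and>
    (\<forall>s. Im s = \<tau> n \<longrightarrow> Re s \<ge> - 2 \<longrightarrow> F s \<noteq> 0 \<and> 1 / norm (F s) \<le> \<bar>K\<bar> * exp ((\<bar>C\<bar> + 1) * (ln (real n + 1))\<^sup>2))"
    by (auto simp: eventually_sequentially)
  show ?thesis by (rule that[of N "\<bar>K\<bar>" "\<bar>C\<bar> + 1"]) (use N in auto)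
qed

lemma norm_pochhammer_le_power:
  fixes z :: complex
  shows "norm (pochhammer z n) \<le> (norm z + real n) ^ n"
proof -
  have "norm (\<Prod>i<n. z + of_nat i) \<le> (\<Prod>i<n. norm z + real n)"
  proof (subst prod_norm[symmetric], rule prod_mono)
    fix i assume "i \<in> {..<n}"
    then show "0 \<le> norm (z + of_nat i) \<and> norm (z + of_nat i) \<le> norm z + real n"
      using norm_triangle_ineq[of z "of_nat i"] by auto
  qed
  then show ?thesis by (simp add: pochhammer_prod atLeast0LessThan)
qed

text \<open>The point 1 - cnj s lies on the same line, so \<open>q\<close> also controls 1 / F
  there. For Re s \<le> -6 the decay estimate uses this, for -6 < Re s < -2 the functional equation
  carries the bound back to s, and further right \<open>q\<close> applies directly.\<close>

lemma zeta_over_F_line_bound: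
  assumes FE: "selberg_functional_equation F Q \<omega> 1 (\<lambda>_. 1) (\<lambda>_. of_real \<mu>)"
    and \<mu>: "0 \<le> \<mu>" "\<mu> < 1" and A: "A \<ge> 0"
  shows "\<exists>C\<ge>0. \<forall>t q. t \<ge> 1 \<longrightarrow> q \<ge> 0 \<longrightarrow>
     (\<forall>s. Im s = t \<longrightarrow> Re s \<ge> - 2 \<longrightarrow> F s \<noteq> 0 \<and> 1 / norm (F s) \<le> q) \<longrightarrow>
     (\<forall>s. Im s = t \<longrightarrow> Re s \<le> A \<longrightarrow>
        norm (riemann_zeta (s - 1) / F s) \<le> C * exp (E * Re s) * (q * (t + A + 16) ^ 9))"
proof -
  have Q: "Q > 0" using FE by (auto simp: selberg_functional_equation_def)
  obtain C1 where C1: "C1 > 0" "\<And>s. Re s \<le> -6 \<Longrightarrow> Im s \<ge> 1 \<Longrightarrow>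
     norm (riemann_zeta (s - 1)) * norm (F (1 - cnj s)) \<le> C1 * exp (E * Re s) * norm (F s)"
    using zeta_over_F_decay[OF FE \<mu>, of E] by blast
  define q0 where "q0 = max 1 (1 / Q)"
  have q0: "q0 \<ge> 1" by (simp add: q0_def)
  \<comment> \<open>For Re s > -6 the exponent 1 - 2 Re s of 1 / Q stays below 13.\<close>
  define c2 where "c2 = exp 2 * q0 powr 13"
  have c2: "c2 \<ge> 1"
  proof -
    have "1 * 1 \<le> exp 2 * q0 powr 13"
      using q0 by (intro mult_mono ge_one_powr_ge_zero) auto
    then show ?thesis by (simp add: c2_def)
  qed
  \<comment> \<open>The 12 is K + 3 in the zeta bound with K = 9, which suffices for Re s > -6. The
    exponential absorbs exp (E Re s) on -6 < Re s \<le> A.\<close>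
  define C2 where "C2 = 12 * c2 * exp (\<bar>E\<bar> * (A + 6))"
  have C2: "C2 \<ge> 0" using c2 by (simp add: C2_def)
  have "norm (riemann_zeta (s - 1) / F s) \<le> (C1 + C2) * exp (E * Re s) * (q * (t + A + 16) ^ 9)"
    if t: "t \<ge> 1" and q: "q \<ge> 0"
      and line: "\<And>s. Im s = t \<Longrightarrow> Re s \<ge> - 2 \<Longrightarrow> F s \<noteq> 0 \<and> 1 / norm (F s) \<le> q"
      and s: "Im s = t" "Re s \<le> A" for t q s
  proof (cases "F s = 0")
    \<comment> \<open>Division by zero gives 0, so the claim is trivial at a zero of
      \<open>F\<close>.\<close>
    case True
    then show ?thesis using C1 C2 q t A by simp
  next
    case Fs: False
    have one: "1 \<le> (t + A + 16) ^ 9" using t A by (intro one_le_power) auto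
    show ?thesis
    proof (cases "Re s \<le> -6")
      case True
      have w: "F (1 - cnj s) \<noteq> 0" "1 / norm (F (1 - cnj s)) \<le> q"
        using line[of "1 - cnj s"] s True by auto
      have "norm (riemann_zeta (s - 1) / F s) \<le> C1 * exp (E * Re s) * (1 / norm (F (1 - cnj s)))"
        using C1(2)[of s] True s t w Fs by (simp add: norm_divide field_simps)
      also have "\<dots> \<le> (C1 + C2) * exp (E * Re s) * (q * (t + A + 16) ^ 9)"
      proof (intro mult_mono)
        show "1 / norm (F (1 - cnj s)) \<le> q * (t + A + 16) ^ 9"
          using mult_mono[OF w(2) one] q by simp
      qed (use C1 C2 q in auto)
      finally show ?thesis .
    next
      case False
      have inv: "1 / norm (F s) \<le> c2 * q"
      proof (cases "Re s \<ge> -2")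
        case True
        then show ?thesis using line[of s] s mult_mono[of 1 c2 "1 / norm (F s)" q] c2 by auto
      next
        case ns: False
        have w: "F (1 - cnj s) \<noteq> 0" "1 / norm (F (1 - cnj s)) \<le> q"
          using line[of "1 - cnj s"] s ns by auto
        have "norm (F (1 - cnj s)) * 1 \<le>
           norm (F (1 - cnj s)) * norm (pochhammer (s + of_real \<mu>) (nat \<lfloor>1 - 2 * Re s\<rfloor>))"
          using s t by (intro mult_left_mono norm_pochhammer_ge_1) auto
        also have "\<dots> \<le> exp 2 * Q powr (2 * Re s - 1) * norm (F s)"
          using s t ns by (intro functional_equation_lower_bound[OF FE \<mu>(1)]) auto
        also have "\<dots> \<le> exp 2 * q0 powr 13 * norm (F s)"
        proof (intro mult_right_mono mult_left_mono)
          have "Q powr (2 * Re s - 1) = (1 / Q) powr (1 - 2 * Re s)"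
            using Q by (simp add: powr_divide powr_minus_divide[symmetric])
          also have "\<dots> \<le> q0 powr (1 - 2 * Re s)"
            using Q ns by (intro powr_mono2) (auto simp: q0_def)
          also have "\<dots> \<le> q0 powr 13"
            using q0 False by (intro powr_mono) auto
          finally show "Q powr (2 * Re s - 1) \<le> q0 powr 13" .
        qed auto
        finally have "norm (F (1 - cnj s)) \<le> c2 * norm (F s)" by (simp add: c2_def)
        then have "1 / norm (F s) \<le> c2 * (1 / norm (F (1 - cnj s)))"
          using w Fs by (simp add: field_simps)
        also have "\<dots> \<le> c2 * q" using w c2 by (intro mult_left_mono) auto
        finally show ?thesis .
      qed
      have "norm (riemann_zeta (s - 1)) \<le> (real 9 + 3) * norm (pochhammer (s - 1) 9)"
        using s t False by (intro norm_riemann_zeta_le) auto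
      also have "\<dots> \<le> 12 * (t + A + 16) ^ 9"
      proof -
        \<comment> \<open>With the 9 from the length of the pochhammer product this yields t + A +
          16.\<close>
        have "norm (s - 1) \<le> \<bar>Re s - 1\<bar> + \<bar>t\<bar>" using cmod_le[of "s - 1"] s by simp
        also have "\<dots> \<le> t + A + 7" using s False A t by auto
        finally have "(norm (s - 1) + real 9) ^ 9 \<le> (t + A + 16) ^ 9"
          by (intro power_mono) auto
        then have "norm (pochhammer (s - 1) 9) \<le> (t + A + 16) ^ 9"
          using norm_pochhammer_le_power[of "s - 1" 9] by linarith
        then show ?thesis by simp
      qed
      finally have zeta: "norm (riemann_zeta (s - 1)) \<le> 12 * (t + A + 16) ^ 9" .
      have "norm (riemann_zeta (s - 1) / F s) = norm (riemann_zeta (s - 1)) * (1 / norm (F s))"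
        by (simp add: norm_divide)
      also have "\<dots> \<le> (12 * (t + A + 16) ^ 9) * (c2 * q)"
        using A t by (intro mult_mono zeta inv) auto
      also have "\<dots> = (12 * c2) * 1 * (q * (t + A + 16) ^ 9)" by simp
      also have "\<dots> \<le> (12 * c2) * (exp (\<bar>E\<bar> * (A + 6)) * exp (E * Re s)) * (q * (t + A + 16) ^ 9)"
      proof (intro mult_right_mono mult_left_mono)
        have "- (E * Re s) \<le> \<bar>E\<bar> * \<bar>Re s\<bar>" by (metis abs_ge_minus_self abs_mult)
        also have "\<dots> \<le> \<bar>E\<bar> * (A + 6)" using s False A by (intro mult_left_mono) auto
        finally show "1 \<le> exp (\<bar>E\<bar> * (A + 6)) * exp (E * Re s)" by (simp flip: exp_add)
      qed (use c2 q t A in auto)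
      also have "\<dots> = C2 * exp (E * Re s) * (q * (t + A + 16) ^ 9)" by (simp add: C2_def)
      also have "\<dots> \<le> (C1 + C2) * exp (E * Re s) * (q * (t + A + 16) ^ 9)"
        using C1 q t A by (intro mult_right_mono) auto
      finally show ?thesis .
    qed
  qed
  moreover have "C1 + C2 \<ge> 0" using C1 C2 by simp
  ultimately show ?thesis by blast
qed

section \<open>The continuation\<close>

text \<open>The function \<open>g\<close> collects the residues below T0, the lower side
  \<open>J\<close> and the lower end of the primitive on the right side. Positivity of Im z serves
  only to identify \<open>g\<close> with the limit.\<close>

lemma contour_limit_expansion:
  fixes F :: "complex \<Rightarrow> complex" and Q \<mu> :: real and \<omega> :: complex and \<tau> :: "nat \<Rightarrow> real"
  assumes F: "F \<in> selberg_class" and \<mu>: "0 \<le> \<mu>" "\<mu> < 1"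
    and FE: "selberg_functional_equation F Q \<omega> 1 (\<lambda>_. 1) (\<lambda>_. of_real \<mu>)"
    and simple: "\<And>\<rho>. \<rho> \<in> zeros F \<Longrightarrow> Im \<rho> > 0 \<Longrightarrow> zorder F \<rho> = 1"
    and heights: "admissible_heights F \<tau>"
  obtains g where "g meromorphic_on UNIV"
    "\<And>z. Im z > 0 \<Longrightarrow> (\<lambda>n. f_partial F 1 (\<lambda>_. 1) (\<lambda>_. of_real \<mu>) (\<tau> n) z) \<longlonglongrightarrow> g z"
proof -
  have hol: "F holomorphic_on - {1}" by (rule selberg_class_holomorphic[OF F])
  have holU: "F holomorphic_on {s. Im s > 0}" by (rule holomorphic_on_subset[OF hol]) auto
  have strip: "0 \<le> Re \<rho> \<and> Re \<rho> \<le> 1" if "Im \<rho> > 0" "F \<rho> = 0" for \<rho>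
    using selberg_class_zeros_in_strip[OF F FE that] .
  have fin: "finite {\<rho>. F \<rho> = 0 \<and> 0 < Im \<rho> \<and> Im \<rho> < T}" for T
    by (rule selberg_class_finite_zeros[OF F strip])
  have zetaU: "(\<lambda>s. riemann_zeta (s - 1)) holomorphic_on {s. Im s > 0}"
    by (rule holomorphic_on_compose_gen[OF _ riemann_zeta_holomorphic, of "\<lambda>s. s - 1", unfolded o_def])
       (auto intro!: holomorphic_intros simp: complex_eq_iff)
  have simple': "zorder F \<rho> = 1" if "Im \<rho> > 0" "F \<rho> = 0" for \<rho>
  proof (rule simple)
    have "F analytic_on {\<rho>}"
      using holU that by (auto simp: analytic_at open_halfspace_Im_gt intro!: exI[of _ "{s. Im s > 0}"])
    then show "\<rho> \<in> zeros F" using that by (simp add: zeros_def)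
  qed (use that in auto)
  obtain n0 K C where n0: "n0 \<ge> 2" and K: "K \<ge> 0" and C: "C > 0"
    and \<tau>: "\<And>n. n \<ge> n0 \<Longrightarrow> real n \<le> \<tau> n \<and> \<tau> n \<le> real n + 1"
    and line: "\<And>n s. n \<ge> n0 \<Longrightarrow> Im s = \<tau> n \<Longrightarrow> Re s \<ge> - 2 \<Longrightarrow>
       F s \<noteq> 0 \<and> 1 / norm (F s) \<le> K * exp (C * (ln (real n + 1))\<^sup>2)"
  proof (rule admissible_heightsD[OF heights], goal_cases)
    case (1 n0 K C)
    show ?case by (rule 1(1)[OF 1(2-6)])
  qed
  \<comment> \<open>Admissibility covers Re s \<ge> -2; further left the strip excludes
    zeros.\<close>
  have line_nz: "F s \<noteq> 0" if "n \<ge> n0" "Im s = \<tau> n" for n s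
    using line[OF that] strip[of s] \<tau>[OF that(1)] that n0 by fastforce
  obtain a :: "nat \<Rightarrow> complex" where a: "\<And>s. Re s > 1 \<Longrightarrow> (\<lambda>n. norm (a n * of_nat n powr (- s))) summable_on {1..}"
      "\<And>s. Re s > 1 \<Longrightarrow> F s = (\<Sum>\<^sub>\<infinity>n\<in>{1..}. a n * of_nat n powr (- s))"
    using F by (auto simp: selberg_class_def)
  have F2: "F 2 \<noteq> 0" by (rule selberg_class_nonzero[OF F]) auto
  obtain A M B :: real and I :: "(nat \<times> nat list) set" and c l where A: "A > 2" and B: "B > 0"
      and lower: "\<And>s. Re s \<ge> A \<Longrightarrow> norm (F s) \<ge> B * exp (- M * Re s)"
      and W: "(\<lambda>i. norm (c i) * exp (- A * l i)) summable_on I"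
      and finI: "\<And>L. finite {i\<in>I. l i \<le> L}"
      and expansion: "\<And>s. Re s = A \<Longrightarrow>
        ((\<lambda>i. c i * exp (- of_real (l i) * s)) has_sum (riemann_zeta (s - 1) / F s)) I"
  proof (rule dirichlet_quotient_expansion[OF a F2], goal_cases)
    case 3
    show ?case by (rule 3(1)[OF 3(2-7)])
  qed auto
  define H where "H = (\<lambda>s. riemann_zeta (s - 1) / F s)"
  have contH: "continuous_on X H" if "\<And>s. s \<in> X \<Longrightarrow> Im s > 0 \<and> F s \<noteq> 0" for X
    unfolding H_def using that
    by (intro holomorphic_on_imp_continuous_on holomorphic_on_divide
          holomorphic_on_subset[OF zetaU] holomorphic_on_subset[OF holU]) auto
  define q where "q = (\<lambda>n. K * exp (C * (ln (real n + 1))\<^sup>2))"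
  have q: "q n \<ge> 0" for n using K by (simp add: q_def)
  have line_bound: "\<exists>C\<ge>0. \<forall>n\<ge>n0. \<forall>s. Im s = \<tau> n \<longrightarrow> Re s \<le> A \<longrightarrow>
      norm (H s) \<le> C * exp (E * Re s) * (q n * (real n + A + 17) ^ 9)" for E
  proof -
    have "A \<ge> 0" using A by simp
    from zeta_over_F_line_bound[OF FE \<mu> this, of E] obtain C where C: "C \<ge> 0" "\<forall>t q. t \<ge> 1 \<longrightarrow> q \<ge> 0 \<longrightarrow>
     (\<forall>s. Im s = t \<longrightarrow> Re s \<ge> - 2 \<longrightarrow> F s \<noteq> 0 \<and> 1 / norm (F s) \<le> q) \<longrightarrow>
     (\<forall>s. Im s = t \<longrightarrow> Re s \<le> A \<longrightarrow>
        norm (riemann_zeta (s - 1) / F s) \<le> C * exp (E * Re s) * (q * (t + A + 16) ^ 9))"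
      by (elim exE conjE)
    have "norm (H s) \<le> C * exp (E * Re s) * (q n * (real n + A + 17) ^ 9)"
      if n: "n \<ge> n0" and s: "Im s = \<tau> n" "Re s \<le> A" for n s
    proof -
      have t: "\<tau> n \<ge> 1" "\<tau> n \<le> real n + 1" using \<tau>[OF n] n n0 by auto
      have "norm (H s) \<le> C * exp (E * Re s) * (q n * (\<tau> n + A + 16) ^ 9)"
        unfolding H_def
      proof (rule C(2)[rule_format, OF t(1) q _ s])
        show "F s \<noteq> 0 \<and> 1 / norm (F s) \<le> q n" if "Im s = \<tau> n" "Re s \<ge> - 2" for s
          using line[OF n that] by (simp add: q_def)
      qed
      also have "\<dots> \<le> C * exp (E * Re s) * (q n * (real n + A + 17) ^ 9)"
        using t A C(1) q by (intro mult_left_mono power_mono) auto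
      finally show ?thesis .
    qed
    then show ?thesis using C(1) by blast
  qed
  \<comment> \<open>An admissible base height keeps zeros off the lower side and makes
    \<open>line_bound\<close> available on it.\<close>
  define T0 where "T0 = \<tau> n0"
  have T0: "T0 \<ge> 2" using \<tau>[of n0] n0 by (simp add: T0_def)
  have contT0: "continuous_on {s. Im s = T0 \<and> Re s \<le> A} H"
    using T0 line_nz[of n0] by (intro contH) (auto simp: T0_def)
  have decayT0: "\<exists>C. \<forall>s. Im s = T0 \<longrightarrow> Re s \<le> A \<longrightarrow> norm (H s) \<le> C * exp (E * Re s)" for E
  proof -
    obtain C where C: "\<And>s. Im s = T0 \<Longrightarrow> Re s \<le> A \<Longrightarrow>
       norm (H s) \<le> C * exp (E * Re s) * (q n0 * (real n0 + A + 17) ^ 9)"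
      using line_bound[of E] by (auto simp: T0_def)
    show ?thesis
      by (rule exI[of _ "C * (q n0 * (real n0 + A + 17) ^ 9)"]) (use C in \<open>auto simp: mult_ac\<close>)
  qed
  obtain J where J: "J holomorphic_on UNIV"
    and Jlim: "\<And>z. (\<lambda>N. contour_integral (linepath (Complex (- real N) T0) (Complex A T0)) (\<lambda>s. exp (s * z) * H s)) \<longlonglongrightarrow> J z"
    by (rule horizontal_ray_entire[OF contT0 _ decayT0]) (use A in auto)
  define G where "G = (\<lambda>T z. \<Sum>\<^sub>\<infinity>i\<in>I. gd_term c l (Complex A T) z i)"
  define R where "R = (\<lambda>\<rho> z. exp (\<rho> * z) * riemann_zeta (\<rho> - 1) / deriv F \<rho>)"
  define P where "P = (\<lambda>z. \<Sum>\<rho> | F \<rho> = 0 \<and> 0 < Im \<rho> \<and> Im \<rho> < T0. R \<rho> z)"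
  define S where "S = (\<lambda>n z. \<Sum>\<rho> | F \<rho> = 0 \<and> T0 < Im \<rho> \<and> Im \<rho> < \<tau> n. R \<rho> z)"
  define g where "g = (\<lambda>z. P z + (J z - G T0 z) / (2 * pi * \<i>))"
  \<comment> \<open>The offset 2 comes from \<tau> n0 \<le> n0 + 1 < n0 + 2 \<le> \<tau> n.\<close>
  have n2: "T0 < \<tau> n" if "n \<ge> n0 + 2" for n
    using \<tau>[of n0] \<tau>[of n] that by (simp add: T0_def)
  have split: "f_partial F 1 (\<lambda>_. 1) (\<lambda>_. of_real \<mu>) (\<tau> n) z = P z + S n z" if n: "n \<ge> n0 + 2" for n z
  proof -
    have eq: "{\<rho>. F \<rho> = 0 \<and> 0 < Im \<rho> \<and> Im \<rho> < \<tau> n} =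
      {\<rho>. F \<rho> = 0 \<and> 0 < Im \<rho> \<and> Im \<rho> < T0} \<union> {\<rho>. F \<rho> = 0 \<and> T0 < Im \<rho> \<and> Im \<rho> < \<tau> n}"
    proof (rule Set.set_eqI)
      fix \<rho>
      have "F \<rho> \<noteq> 0" if "Im \<rho> = T0" using line_nz[of n0 \<rho>] that by (simp add: T0_def)
      then show "\<rho> \<in> {\<rho>. F \<rho> = 0 \<and> 0 < Im \<rho> \<and> Im \<rho> < \<tau> n} \<longleftrightarrow>
          \<rho> \<in> {\<rho>. F \<rho> = 0 \<and> 0 < Im \<rho> \<and> Im \<rho> < T0} \<union> {\<rho>. F \<rho> = 0 \<and> T0 < Im \<rho> \<and> Im \<rho> < \<tau> n}"
        using n2[OF n] T0 by force
    qed
    have "finite {\<rho>. F \<rho> = 0 \<and> T0 < Im \<rho> \<and> Im \<rho> < \<tau> n}"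
      by (rule finite_subset[OF _ fin[of "\<tau> n"]]) (use T0 in auto)
    then show ?thesis
      unfolding f_partial_eq[OF hol] eq P_def S_def R_def using fin[of T0] by (intro sum.union_disjoint) auto
  qed
  have Slim: "(\<lambda>n. 2 * pi * \<i> * S n z) \<longlonglongrightarrow> J z - G T0 z" if z: "Im z > 0" for z
  proof -
    define x y where "x = Re z" and "y = Im z"
    have y: "y > 0" using z by (simp add: y_def)
    \<comment> \<open>The rate 1 - x is chosen so that the product with exp (x Re s) is exp (Re s),
      as the horizontal bound requires.\<close>
    obtain Ct where Ct: "Ct \<ge> 0" "\<And>n s. n \<ge> n0 \<Longrightarrow> Im s = \<tau> n \<Longrightarrow> Re s \<le> A \<Longrightarrow>
      norm (H s) \<le> Ct * exp ((1 - x) * Re s) * (q n * (real n + A + 17) ^ 9)"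
      using line_bound[of "1 - x"] by blast
    define top where "top = (\<lambda>n. Ct * (q n * (real n + A + 17) ^ 9) * exp (- real n * y) * exp A)"
    define W0 where "W0 = (\<Sum>\<^sub>\<infinity>i\<in>I. norm (c i) * exp (- A * l i))"
    define vert where "vert = (\<lambda>n. W0 * (exp (A * x - \<tau> n * y) / y))"
    have vert: "norm (G (\<tau> n) z) \<le> vert n" for n
      using gd_bound(2)[of c "Complex A (\<tau> n)" l I z] W z
      by (simp add: G_def vert_def W0_def x_def y_def)
    have main: "norm (2 * pi * \<i> * S n z - (J z - G T0 z)) \<le> top n + vert n" if n: "n \<ge> n0 + 2" for n
    proof -
      define T where "T = \<tau> n"
      have T: "T0 < T" "real n \<le> T" using n2[OF n] \<tau>[of n] n by (auto simp: T_def)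
      define h where "h = (\<lambda>s. exp (s * z) * H s)"
      define bot where "bot = (\<lambda>N. contour_integral (linepath (Complex (- real N) T0) (Complex A T0)) h)"
      define tp where "tp = (\<lambda>N. contour_integral (linepath (Complex (- real N) T) (Complex A T)) h)"
      define lft where "lft = (\<lambda>N. contour_integral (linepath (Complex (- real N) T0) (Complex (- real N) T)) h)"
      have conth: "continuous_on X h" if "\<And>s. s \<in> X \<Longrightarrow> Im s > 0 \<and> F s \<noteq> 0" for X
        unfolding h_def by (intro continuous_intros contH that)
      have rect: "2 * pi * \<i> * S n z = bot N + (G T z - G T0 z) - tp N - lft N" if N: "N \<ge> 1" for N
      proof -
        let ?r = "rectpath (Complex (- real N) T0) (Complex A T)"
        have "contour_integral ?r (\<lambda>s. (exp (s * z) * riemann_zeta (s - 1)) / F s) =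
           2 * pi * \<i> * (\<Sum>\<rho> | F \<rho> = 0 \<and> T0 < Im \<rho> \<and> Im \<rho> < T. (exp (\<rho> * z) * riemann_zeta (\<rho> - 1)) / deriv F \<rho>)"
        proof (rule rectangle_residues)
          show "(\<lambda>s. exp (s * z) * riemann_zeta (s - 1)) holomorphic_on {s. Im s > 0}"
            by (intro holomorphic_intros zetaU)
          show "- real N < Re \<rho> \<and> Re \<rho> < A" if "Im \<rho> > 0" "F \<rho> = 0" for \<rho>
            using strip[OF that] N A by auto
          show "F s \<noteq> 0" if "Im s = T0 \<or> Im s = T" for s
            using that line_nz[of n0 s] line_nz[of n s] n by (auto simp: T0_def T_def)
        qed (use holU simple' fin T0 T A in auto)
        also have "(\<lambda>s. (exp (s * z) * riemann_zeta (s - 1)) / F s) = h"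
          by (simp add: h_def H_def)
        also have "(\<Sum>\<rho> | F \<rho> = 0 \<and> T0 < Im \<rho> \<and> Im \<rho> < T. (exp (\<rho> * z) * riemann_zeta (\<rho> - 1)) / deriv F \<rho>) = S n z"
          by (simp add: S_def R_def T_def)
        finally have "2 * pi * \<i> * S n z = contour_integral ?r h" by simp
        also have "\<dots> = bot N + contour_integral (linepath (Complex A T0) (Complex A T)) h - tp N - lft N"
          unfolding bot_def tp_def lft_def
        proof (rule contour_integral_rectpath, rule conth)
          fix s assume "s \<in> path_image ?r"
          then have s: "Im s \<ge> T0" "Re s = - real N \<or> Re s = A \<or> Im s = T0 \<or> Im s = T"
            using path_image_rectpath[of "Complex (- real N) T0" "Complex A T"] T A by auto
          have im: "Im s > 0" using s T0 by auto
          moreover have "F s \<noteq> 0"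
            using s(2) strip[OF im] N A line_nz[of n0 s] line_nz[of n s] n by (auto simp: T0_def T_def)
          ultimately show "Im s > 0 \<and> F s \<noteq> 0" by blast
        qed
        also have "contour_integral (linepath (Complex A T0) (Complex A T)) h = G T z - G T0 z"
          unfolding h_def G_def H_def using gd_vertical_integral[OF W z expansion] .
        finally show ?thesis .
      qed
      have tp: "norm (tp N) \<le> top n" for N
      proof -
        have "norm (tp N) \<le> Ct * (q n * (real n + A + 17) ^ 9) * exp (- real n * y) * exp A"
          unfolding tp_def
        proof (rule contour_integral_horizontal_bound)
          show "continuous_on (closed_segment (Complex (- real N) T) (Complex A T)) h"
            using line_nz[of n] n T T0 by (intro conth) (auto simp: closed_segment_same_Im T_def)
          show "- real N \<le> A" using A by auto
          show "0 \<le> Ct * (q n * (real n + A + 17) ^ 9) * exp (- real n * y)"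
            using Ct q A by simp
          fix s assume s: "Im s = T" "- real N \<le> Re s" "Re s \<le> A"
          have "norm (h s) = exp (Re s * x - T * y) * norm (H s)"
            using s by (simp add: h_def norm_mult x_def y_def)
          also have "\<dots> \<le> exp (Re s * x - real n * y) * (Ct * exp ((1 - x) * Re s) * (q n * (real n + A + 17) ^ 9))"
            using Ct(2)[of n s] s n T y Ct(1) q A by (intro mult_mono) (auto simp: T_def)
          also have "\<dots> = Ct * (q n * (real n + A + 17) ^ 9) * exp (- real n * y) * (exp (Re s * x) * exp ((1 - x) * Re s))"
            by (simp add: exp_diff exp_minus divide_inverse)
          also have "exp (Re s * x) * exp ((1 - x) * Re s) = exp (Re s)"
            by (simp add: algebra_simps flip: exp_add)
          finally show "norm (h s) \<le> Ct * (q n * (real n + A + 17) ^ 9) * exp (- real n * y) * exp (Re s)" .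
        qed
        then show ?thesis by (simp add: top_def)
      qed
      have lft: "lft \<longlonglongrightarrow> 0"
      proof -
        \<comment> \<open>On Re s = -N the reflected value of \<open>F\<close> may be as small as B
          exp (- M (1 + N)). The rate M + 1 - x pays for this and for exp (x Re s), and leaves exp
          (- N).\<close>
        obtain C1 where C1: "C1 > 0" "\<And>s. Re s \<le> -6 \<Longrightarrow> Im s \<ge> 1 \<Longrightarrow>
           norm (riemann_zeta (s - 1)) * norm (F (1 - cnj s)) \<le> C1 * exp ((M + 1 - x) * Re s) * norm (F s)"
          using zeta_over_F_decay[OF FE \<mu>, of "M + 1 - x"] by blast
        define D where "D = C1 / B * exp M * (T - T0)"
        have bound: "norm (lft N) \<le> D * exp (- real N)" if N: "real N \<ge> 6" "real N \<ge> A" for N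
        proof -
          have im: "Im s \<ge> T0 \<and> Re s = - real N" if "s \<in> closed_segment (Complex (- real N) T0) (Complex (- real N) T)" for s
            using that T by (auto simp: closed_segment_same_Re closed_segment_eq_real_ivl)
          have nz: "F s \<noteq> 0" if "s \<in> closed_segment (Complex (- real N) T0) (Complex (- real N) T)" for s
            using strip[of s] im[OF that] T0 N by auto
          have "norm (lft N) \<le> (C1 / B * exp M * exp (- real N)) * norm (Complex (- real N) T - Complex (- real N) T0)"
            unfolding lft_def
          proof (rule contour_integral_bound_linepath)
            show "h contour_integrable_on linepath (Complex (- real N) T0) (Complex (- real N) T)"
              using im nz T0 by (intro contour_integrable_continuous_linepath conth) force
            show "0 \<le> C1 / B * exp M * exp (- real N)" using C1 B by simp
            fix s assume s: "s \<in> closed_segment (Complex (- real N) T0) (Complex (- real N) T)"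
            note im = im[OF s] and nz = nz[OF s]
            have low: "B * exp (- M * (1 + real N)) \<le> norm (F (1 - cnj s))"
              using lower[of "1 - cnj s"] im N by simp
            have pos: "B * exp (- M * (1 + real N)) > 0" using B by simp
            have "norm (H s) * (B * exp (- M * (1 + real N))) \<le> norm (H s) * norm (F (1 - cnj s))"
              by (intro mult_left_mono low) auto
            also have "\<dots> \<le> C1 * exp ((M + 1 - x) * Re s)"
              using C1(2)[of s] im N T0 nz by (simp add: H_def norm_divide field_simps)
            finally have "norm (H s) \<le> C1 * exp ((M + 1 - x) * Re s) / (B * exp (- M * (1 + real N)))"
              using pos by (simp only: pos_le_divide_eq)
            also have "\<dots> = C1 / B * (exp ((M + 1 - x) * Re s) * exp (M * (1 + real N)))"
              unfolding mult_minus_left exp_minus by (simp add: divide_inverse mult_ac)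
            finally have Hs: "norm (H s) \<le> C1 / B * (exp ((M + 1 - x) * Re s) * exp (M * (1 + real N)))" .
            have "norm (h s) = exp (Re s * x - Im s * y) * norm (H s)"
              by (simp add: h_def norm_mult x_def y_def)
            also have "\<dots> \<le> exp (Re s * x) * (C1 / B * (exp ((M + 1 - x) * Re s) * exp (M * (1 + real N))))"
              using y im T0 by (intro mult_mono Hs) auto
            also have "\<dots> = C1 / B * (exp (Re s * x) * exp ((M + 1 - x) * Re s) * exp (M * (1 + real N)))"
              by simp
            also have "exp (Re s * x) * exp ((M + 1 - x) * Re s) * exp (M * (1 + real N)) = exp M * exp (- real N)"
              using im by (simp add: algebra_simps flip: exp_add)
            finally show "norm (h s) \<le> C1 / B * exp M * exp (- real N)" by simp
          qed
          also have "norm (Complex (- real N) T - Complex (- real N) T0) = T - T0"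
            using T by (simp add: cmod_def)
          finally show ?thesis by (simp add: D_def mult_ac)
        qed
        have "(\<lambda>N. D * exp (- real N)) \<longlonglongrightarrow> D * 0"
          by (intro tendsto_mult tendsto_const filterlim_compose[OF exp_at_bot]
             filterlim_compose[OF filterlim_uminus_at_bot_at_top] filterlim_real_sequentially)
        moreover have "\<forall>\<^sub>F N in sequentially. norm (lft N) \<le> D * exp (- real N)"
          using eventually_ge_at_top[of "max 6 (nat \<lceil>A\<rceil>)"]
          by eventually_elim (rule bound, auto)
        ultimately show ?thesis by (intro Lim_null_comparison[of lft]) auto
      qed
      \<comment> \<open>By \<open>rect\<close> this combination is the upper side
        \<open>tp N\<close>. Its bound is uniform in N and so passes to the limit of the
        combination.\<close>
      have lim: "(\<lambda>N. bot N + (G T z - G T0 z) - lft N - 2 * pi * \<i> * S n z) \<longlonglongrightarrow>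
         J z + (G T z - G T0 z) - 0 - 2 * pi * \<i> * S n z"
        using Jlim[of z] unfolding bot_def h_def[symmetric] by (intro tendsto_intros lft)
      have 1: "norm (J z + (G T z - G T0 z) - 0 - 2 * pi * \<i> * S n z) \<le> top n"
      proof (rule tendsto_upperbound[OF tendsto_norm[OF lim]])
        show "\<forall>\<^sub>F N in sequentially. norm (bot N + (G T z - G T0 z) - lft N - 2 * pi * \<i> * S n z) \<le> top n"
          using eventually_ge_at_top[of 1]
        proof eventually_elim
          case (elim N)
          have "bot N + (G T z - G T0 z) - lft N - 2 * pi * \<i> * S n z = tp N"
            using rect[OF elim] by simp
          then show ?case using tp[of N] by simp
        qed
      qed auto
      have 2: "norm (G T z) \<le> vert n" using vert[of n] by (simp add: T_def)
      have 3: "2 * pi * \<i> * S n z - (J z - G T0 z) =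
          G T z - (J z + (G T z - G T0 z) - 0 - 2 * pi * \<i> * S n z)" by simp
      show ?thesis
        unfolding 3 using norm_triangle_ineq4[of "G T z" "J z + (G T z - G T0 z) - 0 - 2 * pi * \<i> * S n z"] 1 2
        by linarith
    qed
    have "top \<longlonglongrightarrow> 0"
    proof -
      \<comment> \<open>The admissible bound is only exp (O(ln^2 n)), hence subexponential, and exp
        (- n y) wins for every y > 0.\<close>
      have "(\<lambda>n. exp (C * (ln (real n + 1))\<^sup>2) * (real n + A + 17) ^ 9 * exp (- real n * y)) \<longlonglongrightarrow> 0"
        using y C by real_asymp
      from tendsto_mult_right_zero[OF this, of "Ct * K * exp A"]
      show ?thesis by (simp add: top_def q_def mult_ac)
    qed
    moreover have "vert \<longlonglongrightarrow> 0"
    proof (rule Lim_null_comparison)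
      have W0: "W0 \<ge> 0" unfolding W0_def by (rule infsum_nonneg) auto
      show "\<forall>\<^sub>F n in sequentially. norm (vert n) \<le> W0 * (exp (A * x - real n * y) / y)"
        using eventually_ge_at_top[of n0]
      proof eventually_elim
        case (elim n)
        have "vert n \<le> W0 * (exp (A * x - real n * y) / y)"
          unfolding vert_def using \<tau>[OF elim] y W0 by (intro mult_left_mono divide_right_mono) auto
        moreover have "vert n \<ge> 0" using W0 y by (simp add: vert_def)
        ultimately show ?case by simp
      qed
      show "(\<lambda>n. W0 * (exp (A * x - real n * y) / y)) \<longlonglongrightarrow> 0"
        using y by real_asymp
    qed
    ultimately have "(\<lambda>n. top n + vert n) \<longlonglongrightarrow> 0"
      by (rule tendsto_add_zero)
    then have "(\<lambda>n. 2 * pi * \<i> * S n z - (J z - G T0 z)) \<longlonglongrightarrow> 0"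
      by (rule Lim_null_comparison[rotated])
         (use main in \<open>auto simp: eventually_sequentially intro!: exI[of _ "n0 + 2"]\<close>)
    then show ?thesis by (simp only: LIM_zero_iff)
  qed
  show ?thesis
  proof (rule that[of g])
    have "G T0 meromorphic_on UNIV"
      unfolding G_def using W by (intro gd_meromorphic finI) simp
    moreover have "J meromorphic_on UNIV"
      using J by (intro analytic_on_imp_meromorphic_on) (simp add: analytic_on_open)
    moreover have "P meromorphic_on UNIV"
      unfolding P_def R_def
      by (intro analytic_on_imp_meromorphic_on) (auto simp: analytic_on_open divide_inverse intro!: holomorphic_intros)
    ultimately show "g meromorphic_on UNIV"
      unfolding g_def by (intro meromorphic_intros)
    fix z :: complex assume z: "Im z > 0"
    have "(\<lambda>n. P z + (2 * pi * \<i> * S n z) / (2 * pi * \<i>)) \<longlonglongrightarrow> g z"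
      unfolding g_def by (intro tendsto_intros Slim[OF z]) auto
    then have "(\<lambda>n. P z + S n z) \<longlonglongrightarrow> g z" by simp
    then show "(\<lambda>n. f_partial F 1 (\<lambda>_. 1) (\<lambda>_. of_real \<mu>) (\<tau> n) z) \<longlonglongrightarrow> g z"
      by (rule Lim_transform_eventually)
         (use split in \<open>auto simp: eventually_sequentially intro!: exI[of _ "n0 + 2"]\<close>)
  qed
qed

theorem theorem4p2:
  fixes F :: "complex \<Rightarrow> complex" and Q \<mu> :: real and \<omega> :: complex and \<tau> :: "nat \<Rightarrow> real"
  assumes "F \<in> selberg_class_poly"
    and "0 \<le> \<mu>" and "\<mu> < 1"
    and "selberg_functional_equation F Q \<omega> 1 (\<lambda>_. 1) (\<lambda>_. of_real \<mu>)"
    and "\<And>\<rho>. \<rho> \<in> zeros F \<Longrightarrow> Im \<rho> > 0 \<Longrightarrow> zorder F \<rho> = 1"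
    and "admissible_heights F \<tau>"
  shows "(\<forall>z. Im z > 0 \<longrightarrow> convergent (\<lambda>n. f_partial F 1 (\<lambda>_. 1) (\<lambda>_. of_real \<mu>) (\<tau> n) z)) \<and>
    (\<exists>g. g meromorphic_on {z. Im z > - pi} \<and>
         (\<forall>z. Im z > 0 \<longrightarrow> g z = f_fun F 1 (\<lambda>_. 1) (\<lambda>_. of_real \<mu>) \<tau> z))"
proof -
  have "F \<in> selberg_class" using assms(1) by (simp add: selberg_class_poly_def)
  then obtain g where g: "g meromorphic_on UNIV"
    "\<And>z. Im z > 0 \<Longrightarrow> (\<lambda>n. f_partial F 1 (\<lambda>_. 1) (\<lambda>_. of_real \<mu>) (\<tau> n) z) \<longlonglongrightarrow> g z"
    using contour_limit_expansion[OF _ assms(2-6)] by blast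
  show ?thesis
  proof (intro conjI exI allI impI)
    show "g meromorphic_on {z. Im z > - pi}" using g(1) by (rule meromorphic_on_subset) auto
  next
    fix z :: complex assume z: "Im z > 0"
    show "convergent (\<lambda>n. f_partial F 1 (\<lambda>_. 1) (\<lambda>_. of_real \<mu>) (\<tau> n) z)"
      using g(2)[OF z] by (rule convergentI)
    show "g z = f_fun F 1 (\<lambda>_. 1) (\<lambda>_. of_real \<mu>) \<tau> z"
      unfolding f_fun_def using limI[OF g(2)[OF z]] by simp
  qed
qed

end
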